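(* Let $G$ be a groupoid over $M$ in a tangent category, let $\pi:A\to M$ with anchor $\varrho$ be its associated anchored bundle, and define $\alpha:A\times_{\varrho,T(\pi)}T(A)\to T(A)$ by $$\alpha(v,w)=cw\circ 0v\circ(c0pw)^{-1}.$$ Then $\alpha$ is a linear bundle morphism from $(A\times_{\varrho,T(\pi)}T(A),\pi_0)$ to $(T(A),p)$ over $\mathrm{id}_A$.
   Context: Conventions: composition of arrows is juxtaposition in applicative order ($gf$: first $f$, then $g$); subscripts of natural transformations are omitted; equations may be read on generalised elements. An additive bundle over $M$ is a commutative monoid in the slice category over $M$: an arrow $q:E\to M$, zero $\xi:M\to E$, addition $+_q$. A morphism is a commuting square preserving zero and addition. A tangent category is a category with an endofunctor $T$ and natural transformations $p:T\Rightarrow\mathrm{id}$, $0:\mathrm{id}\Rightarrow T$, $+:T\times_{p,p}T\Rightarrow T$, $l:T\Rightarrow T^2$, $c:T^2\Rightarrow T^2$ such that: pullback powers of $p$ exist and are preserved by $T$; each $(p_M,0_M,+_M)$ is an additive bundle; $(l,0):p\Rightarrow T(p)$ and $(c,\mathrm{id}):T(p)\Rightarrow p$ are additive bundle morphisms; $cc=\mathrm{id}$, $T(c)cT(c)=cT(c)c$, $cl=l$, $T(l)l=ll$, $cT(c)l=T(l)c$; and $\mu(a,b)=T(+)(0b,la)$, $T(M)\times_MT(M)\to T^2(M)$, is an equaliser of $T(p)$ and $0pp$. Standing assumptions: negatives (additive bundles are commutative groups in the slice) and all limits used exist and are preserved by $T$. The groupoid $G$ has identity $e:M\to G$, source and target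 $s,t:G\to M$, inverse $(-)^{-1}$; $g\circ h$ is defined when $s(g)=t(h)$. In $T^2(G)$, $\circ$ and $(-)^{-1}$ denote the operations obtained by applying $T^2$, so $g\circ h$ is defined when $T^2(s)g=T^2(t)h$. Associated anchored bundle: $A$ is the pullback of $(p,T(s)):T(G)\to G\times T(M)$ along $(e,0):M\to G\times T(M)$, with projection $\pi:A\to M$ and monomorphism $\iota:A\rightarrowtail T(G)$. Thus elements of $A$ are $v\in T(G)$ with $pv=em$, $T(s)v=0m$, $m=\pi v$; elements of $T(A)$ are regarded as elements $w\in T^2(G)$ with $T(p)w=T(e)T(\pi)w$ and $T^2(s)w=T(0)T(\pi)w$. Zero section, addition and lift are inherited from $(T(G),p)$: $\xi=0e$, $\lambda v=lv$. The anchor is $\varrho=T(t)\iota:A\to T(M)$. The prolongation $P=A\times_{\varrho,T(\pi)}T(A)$ is the pullback of $\varrho$ and $T(\pi):T(A)\to T(M)$, projections $\pi_0,\pi_1$. The composite defining $\alpha(v,w)$ is defined in $T^2(G)$ and lies in $T(A)$. A bundle morphism from $(E,q)$ to $(E',q')$ with lifts $\lambda,\lambda'$ over $\phi_0$ is $\phi_1:E\to E'$ with $q'\phi_1=\phi_0q$; it is linear if $T(\phi_1)\lambda=\lambda'\phi_1$. Here $(P,\pi_0)$ has lift $0\times cT(\lambda)$ and $(T(A),p)$ has lift $l$; so the claim says $p\alpha=\pi_0$ and $T(\alpha)(0v,cT(\lambda)w)=l\alpha(v,w)$. *)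

theory Defs
  imports Main
begin

section \<open>Categories\<close>

text \<open>Composition \<open>g \<cdot> f\<close> is in applicative order (first \<open>f\<close>, then \<open>g\<close>); it is only constrained on
  composable arrows, and arbitrary elsewhere.\<close>

record ('o, 'a) category_data =
  obj :: "'o set"
  arr :: "'a set"
  src :: "'a \<Rightarrow> 'o"
  tgt :: "'a \<Rightarrow> 'o"
  ident :: "'o \<Rightarrow> 'a"
  comp :: "'a \<Rightarrow> 'a \<Rightarrow> 'a" (infixl "\<cdot>\<index>" 70)

definition hom :: "('o, 'a, 'x) category_data_scheme \<Rightarrow> 'o \<Rightarrow> 'o \<Rightarrow> 'a set" where
  "hom C X Y = {f \<in> arr C. src C f = X \<and> tgt C f = Y}"

locale category =
  fixes C :: "('o, 'a, 'x) category_data_scheme" (structure)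
  assumes src_in_obj: "f \<in> arr C \<Longrightarrow> src C f \<in> obj C"
    and tgt_in_obj: "f \<in> arr C \<Longrightarrow> tgt C f \<in> obj C"
    and ident_in_hom: "X \<in> obj C \<Longrightarrow> ident C X \<in> hom C X X"
    and comp_in_hom: "f \<in> hom C X Y \<Longrightarrow> g \<in> hom C Y Z \<Longrightarrow> g \<cdot> f \<in> hom C X Z"
    and comp_ident_right: "f \<in> hom C X Y \<Longrightarrow> f \<cdot> ident C X = f"
    and comp_ident_left: "f \<in> hom C X Y \<Longrightarrow> ident C Y \<cdot> f = f"
    and comp_assoc: "f \<in> hom C W X \<Longrightarrow> g \<in> hom C X Y \<Longrightarrow> h \<in> hom C Y Z \<Longrightarrow>
      (h \<cdot> g) \<cdot> f = h \<cdot> (g \<cdot> f)"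

text \<open>An additive bundle consists of a projection, a zero section, the two projections of a chosen
  fibre product of the bundle with itself, and the addition defined on that fibre product.\<close>

record 'a additive_bundle_data =
  bproj :: 'a
  bzero :: 'a
  bfst :: 'a
  bsnd :: 'a
  badd :: 'a

text \<open>An internal groupoid: \<open>gfst\<close> and \<open>gsnd\<close> send a composable pair \<open>(g, h)\<close>, \<open>s g = t h\<close>, to
  \<open>g\<close> and \<open>h\<close>; \<open>gmult\<close> sends it to \<open>g \<circ> h\<close>.\<close>

record ('o, 'a) groupoid_data =
  gobj :: 'o
  garr :: 'o
  gid :: 'a
  gsrc :: 'a
  gtgt :: 'a
  ginv :: 'a
  gpairs :: 'o
  gfst :: 'a
  gsnd :: 'a
  gmult :: 'a

context
  fixes C :: "('o, 'a, 'x) category_data_scheme" (structure)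
begin

definition endofunctor :: "('o \<Rightarrow> 'o) \<Rightarrow> ('a \<Rightarrow> 'a) \<Rightarrow> bool" where
  "endofunctor FO FA \<longleftrightarrow>
    (\<forall>X\<in>obj C. FO X \<in> obj C) \<and>
    (\<forall>X Y. \<forall>f\<in>hom C X Y. FA f \<in> hom C (FO X) (FO Y)) \<and>
    (\<forall>X\<in>obj C. FA (ident C X) = ident C (FO X)) \<and>
    (\<forall>X Y Z. \<forall>f\<in>hom C X Y. \<forall>g\<in>hom C Y Z. FA (g \<cdot> f) = FA g \<cdot> FA f)"

definition natural_transformation ::
  "('o \<Rightarrow> 'o) \<Rightarrow> ('a \<Rightarrow> 'a) \<Rightarrow> ('o \<Rightarrow> 'o) \<Rightarrow> ('a \<Rightarrow> 'a) \<Rightarrow> ('o \<Rightarrow> 'a) \<Rightarrow> bool" where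
  "natural_transformation FO FA HO HA \<tau> \<longleftrightarrow>
    (\<forall>X\<in>obj C. \<tau> X \<in> hom C (FO X) (HO X)) \<and>
    (\<forall>X Y. \<forall>f\<in>hom C X Y. \<tau> Y \<cdot> FA f = HA f \<cdot> \<tau> X)"

definition is_pullback :: "'a \<Rightarrow> 'a \<Rightarrow> 'o \<Rightarrow> 'a \<Rightarrow> 'a \<Rightarrow> bool" where
  "is_pullback f g P a b \<longleftrightarrow>
    (\<exists>X Y Z. f \<in> hom C X Z \<and> g \<in> hom C Y Z \<and> a \<in> hom C P X \<and> b \<in> hom C P Y \<and>
      f \<cdot> a = g \<cdot> b \<and>
      (\<forall>W. \<forall>x\<in>hom C W X. \<forall>y\<in>hom C W Y. f \<cdot> x = g \<cdot> y \<longrightarrow>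
        (\<exists>!u. u \<in> hom C W P \<and> a \<cdot> u = x \<and> b \<cdot> u = y)))"

definition is_product :: "'o \<Rightarrow> 'o \<Rightarrow> 'o \<Rightarrow> 'a \<Rightarrow> 'a \<Rightarrow> bool" where
  "is_product X Y P a b \<longleftrightarrow>
    a \<in> hom C P X \<and> b \<in> hom C P Y \<and>
    (\<forall>W. \<forall>x\<in>hom C W X. \<forall>y\<in>hom C W Y.
      (\<exists>!u. u \<in> hom C W P \<and> a \<cdot> u = x \<and> b \<cdot> u = y))"

definition is_equaliser :: "'a \<Rightarrow> 'a \<Rightarrow> 'a \<Rightarrow> bool" where
  "is_equaliser k f g \<longleftrightarrow>
    (\<exists>K X Y. k \<in> hom C K X \<and> f \<in> hom C X Y \<and> g \<in> hom C X Y \<and> f \<cdot> k = g \<cdot> k \<and>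
      (\<forall>W. \<forall>x\<in>hom C W X. f \<cdot> x = g \<cdot> x \<longrightarrow> (\<exists>!u. u \<in> hom C W K \<and> k \<cdot> u = x)))"

text \<open>The \<open>n\<close>-fold power of \<open>q : E \<rightarrow> M\<close> in the slice over \<open>M\<close>, with structure map \<open>b\<close> to \<open>M\<close> and
  projections \<open>\<pi> i\<close> to \<open>E\<close> for \<open>i < n\<close>.\<close>

definition is_pullback_power :: "nat \<Rightarrow> 'a \<Rightarrow> 'a \<Rightarrow> (nat \<Rightarrow> 'a) \<Rightarrow> bool" where
  "is_pullback_power n q b \<pi> \<longleftrightarrow>
    (\<exists>L E M. q \<in> hom C E M \<and> b \<in> hom C L M \<and> (\<forall>i<n. \<pi> i \<in> hom C L E \<and> q \<cdot> \<pi> i = b) \<and>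
      (\<forall>W. \<forall>y\<in>hom C W M. \<forall>x. (\<forall>i<n. x i \<in> hom C W E \<and> q \<cdot> x i = y) \<longrightarrow>
        (\<exists>!u. u \<in> hom C W L \<and> b \<cdot> u = y \<and> (\<forall>i<n. \<pi> i \<cdot> u = x i))))"

text \<open>\<open>pair a b x y\<close> is the generalised element \<open>(x, y)\<close> of the pullback or product whose projections
  are \<open>a\<close> and \<open>b\<close>.\<close>

definition pair :: "'a \<Rightarrow> 'a \<Rightarrow> 'a \<Rightarrow> 'a \<Rightarrow> 'a" where
  "pair a b x y = (THE u. u \<in> hom C (src C x) (src C a) \<and> a \<cdot> u = x \<and> b \<cdot> u = y)"

definition bundle_add :: "'a additive_bundle_data \<Rightarrow> 'a \<Rightarrow> 'a \<Rightarrow> 'a" where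
  "bundle_add B x y = badd B \<cdot> pair (bfst B) (bsnd B) x y"

text \<open>Commutative monoids in the slice over \<open>M\<close>, the equations being read on generalised elements.\<close>

definition additive_bundle :: "'o \<Rightarrow> 'o \<Rightarrow> 'a additive_bundle_data \<Rightarrow> bool" where
  "additive_bundle E M B \<longleftrightarrow>
    bproj B \<in> hom C E M \<and> bzero B \<in> hom C M E \<and> bproj B \<cdot> bzero B = ident C M \<and>
    is_pullback (bproj B) (bproj B) (src C (bfst B)) (bfst B) (bsnd B) \<and>
    badd B \<in> hom C (src C (bfst B)) E \<and> bproj B \<cdot> badd B = bproj B \<cdot> bfst B \<and>
    (\<forall>W. \<forall>x\<in>hom C W E. bundle_add B (bzero B \<cdot> (bproj B \<cdot> x)) x = x) \<and>
    (\<forall>W. \<forall>x\<in>hom C W E. \<forall>y\<in>hom C W E. bproj B \<cdot> x = bproj B \<cdot> y \<longrightarrow>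
      bundle_add B x y = bundle_add B y x) \<and>
    (\<forall>W. \<forall>x\<in>hom C W E. \<forall>y\<in>hom C W E. \<forall>z\<in>hom C W E.
      bproj B \<cdot> x = bproj B \<cdot> y \<and> bproj B \<cdot> y = bproj B \<cdot> z \<longrightarrow>
      bundle_add B (bundle_add B x y) z = bundle_add B x (bundle_add B y z))"

definition has_negation :: "'o \<Rightarrow> 'a additive_bundle_data \<Rightarrow> bool" where
  "has_negation E B \<longleftrightarrow>
    (\<exists>n\<in>hom C E E. bproj B \<cdot> n = bproj B \<and> bundle_add B n (ident C E) = bzero B \<cdot> bproj B)"

definition additive_bundle_morphism ::
  "'a additive_bundle_data \<Rightarrow> 'a additive_bundle_data \<Rightarrow> 'a \<Rightarrow> 'a \<Rightarrow> bool" where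
  "additive_bundle_morphism B B' \<phi>1 \<phi>0 \<longleftrightarrow>
    \<phi>1 \<in> hom C (src C (bproj B)) (src C (bproj B')) \<and>
    \<phi>0 \<in> hom C (tgt C (bproj B)) (tgt C (bproj B')) \<and>
    bproj B' \<cdot> \<phi>1 = \<phi>0 \<cdot> bproj B \<and>
    \<phi>1 \<cdot> bzero B = bzero B' \<cdot> \<phi>0 \<and>
    \<phi>1 \<cdot> badd B = bundle_add B' (\<phi>1 \<cdot> bfst B) (\<phi>1 \<cdot> bsnd B)"

definition gcomp :: "('o, 'a) groupoid_data \<Rightarrow> 'a \<Rightarrow> 'a \<Rightarrow> 'a" where
  "gcomp G g h = gmult G \<cdot> pair (gfst G) (gsnd G) g h"

definition internal_groupoid :: "('o, 'a) groupoid_data \<Rightarrow> bool" where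
  "internal_groupoid G \<longleftrightarrow>
    gid G \<in> hom C (gobj G) (garr G) \<and>
    gsrc G \<in> hom C (garr G) (gobj G) \<and> gtgt G \<in> hom C (garr G) (gobj G) \<and>
    ginv G \<in> hom C (garr G) (garr G) \<and>
    is_pullback (gsrc G) (gtgt G) (gpairs G) (gfst G) (gsnd G) \<and>
    gmult G \<in> hom C (gpairs G) (garr G) \<and>
    gsrc G \<cdot> gid G = ident C (gobj G) \<and> gtgt G \<cdot> gid G = ident C (gobj G) \<and>
    gsrc G \<cdot> gmult G = gsrc G \<cdot> gsnd G \<and> gtgt G \<cdot> gmult G = gtgt G \<cdot> gfst G \<and>
    gsrc G \<cdot> ginv G = gtgt G \<and> gtgt G \<cdot> ginv G = gsrc G \<and>
    (\<forall>W. \<forall>g\<in>hom C W (garr G).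
      gcomp G g (gid G \<cdot> (gsrc G \<cdot> g)) = g \<and> gcomp G (gid G \<cdot> (gtgt G \<cdot> g)) g = g \<and>
      gcomp G g (ginv G \<cdot> g) = gid G \<cdot> (gtgt G \<cdot> g) \<and>
      gcomp G (ginv G \<cdot> g) g = gid G \<cdot> (gsrc G \<cdot> g)) \<and>
    (\<forall>W. \<forall>g\<in>hom C W (garr G). \<forall>h\<in>hom C W (garr G). \<forall>k\<in>hom C W (garr G).
      gsrc G \<cdot> g = gtgt G \<cdot> h \<and> gsrc G \<cdot> h = gtgt G \<cdot> k \<longrightarrow>
      gcomp G (gcomp G g h) k = gcomp G g (gcomp G h k))"

end


section \<open>Tangent categories\<close>

text \<open>\<open>Tfst M\<close> and \<open>Tsnd M\<close> are the projections of the chosen pullback of \<open>Tproj M\<close> along itself, on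
  which \<open>Tplus M\<close> is defined.\<close>

record ('o, 'a) tangent_data = "('o, 'a) category_data" +
  TO :: "'o \<Rightarrow> 'o"
  TA :: "'a \<Rightarrow> 'a"
  Tproj :: "'o \<Rightarrow> 'a"
  Tzero :: "'o \<Rightarrow> 'a"
  Tfst :: "'o \<Rightarrow> 'a"
  Tsnd :: "'o \<Rightarrow> 'a"
  Tplus :: "'o \<Rightarrow> 'a"
  Tlift :: "'o \<Rightarrow> 'a"
  Tflip :: "'o \<Rightarrow> 'a"

context
  fixes C :: "('o, 'a, 'x) tangent_data_scheme" (structure)
begin

definition T2O :: "'o \<Rightarrow> 'o" where
  "T2O M = src C (Tfst C M)"

definition T2A :: "'a \<Rightarrow> 'a" where
  "T2A f = pair C (Tfst C (tgt C f)) (Tsnd C (tgt C f))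
    (TA C f \<cdot> Tfst C (src C f)) (TA C f \<cdot> Tsnd C (src C f))"

definition tangent_bundle :: "'o \<Rightarrow> 'a additive_bundle_data" where
  "tangent_bundle M = \<lparr>bproj = Tproj C M, bzero = Tzero C M, bfst = Tfst C M, bsnd = Tsnd C M,
    badd = Tplus C M\<rparr>"

definition T_bundle :: "'a additive_bundle_data \<Rightarrow> 'a additive_bundle_data" where
  "T_bundle B = \<lparr>bproj = TA C (bproj B), bzero = TA C (bzero B), bfst = TA C (bfst B),
    bsnd = TA C (bsnd B), badd = TA C (badd B)\<rparr>"

text \<open>\<open>\<mu>(a, b) = T(+)(0 b, l a)\<close>\<close>

definition Tmu :: "'o \<Rightarrow> 'a" where
  "Tmu M = TA C (Tplus C M) \<cdot> pair C (TA C (Tfst C M)) (TA C (Tsnd C M))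
    (Tzero C (TO C M) \<cdot> Tsnd C M) (Tlift C M \<cdot> Tfst C M)"

end

locale tangent_category = category C
  for C :: "('o, 'a, 'x) tangent_data_scheme" (structure) +
  assumes T_functor: "endofunctor C (TO C) (TA C)"
    and proj_natural: "natural_transformation C (TO C) (TA C) id id (Tproj C)"
    and zero_natural: "natural_transformation C id id (TO C) (TA C) (Tzero C)"
    and plus_natural: "natural_transformation C (T2O C) (T2A C) (TO C) (TA C) (Tplus C)"
    and lift_natural:
      "natural_transformation C (TO C) (TA C) (TO C \<circ> TO C) (TA C \<circ> TA C) (Tlift C)"
    and flip_natural:
      "natural_transformation C (TO C \<circ> TO C) (TA C \<circ> TA C) (TO C \<circ> TO C) (TA C \<circ> TA C) (Tflip C)"
    and powers_exist: "M \<in> obj C \<Longrightarrow> \<exists>b \<pi>. is_pullback_power C n (Tproj C M) b \<pi>"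
    and powers_preserved: "M \<in> obj C \<Longrightarrow> is_pullback_power C n (Tproj C M) b \<pi> \<Longrightarrow>
      is_pullback_power C n (TA C (Tproj C M)) (TA C b) (\<lambda>i. TA C (\<pi> i))"
    and tangent_additive: "M \<in> obj C \<Longrightarrow> additive_bundle C (TO C M) M (tangent_bundle C M)"
    and lift_additive: "M \<in> obj C \<Longrightarrow>
      additive_bundle_morphism C (tangent_bundle C M) (T_bundle C (tangent_bundle C M))
        (Tlift C M) (Tzero C M)"
    and flip_additive: "M \<in> obj C \<Longrightarrow>
      additive_bundle_morphism C (T_bundle C (tangent_bundle C M)) (tangent_bundle C (TO C M))
        (Tflip C M) (ident C (TO C M))"
    and flip_flip: "M \<in> obj C \<Longrightarrow> Tflip C M \<cdot> Tflip C M = ident C (TO C (TO C M))"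
    and flip_hexagon: "M \<in> obj C \<Longrightarrow>
      TA C (Tflip C M) \<cdot> Tflip C (TO C M) \<cdot> TA C (Tflip C M) =
      Tflip C (TO C M) \<cdot> TA C (Tflip C M) \<cdot> Tflip C (TO C M)"
    and flip_lift: "M \<in> obj C \<Longrightarrow> Tflip C M \<cdot> Tlift C M = Tlift C M"
    and lift_lift: "M \<in> obj C \<Longrightarrow> TA C (Tlift C M) \<cdot> Tlift C M = Tlift C (TO C M) \<cdot> Tlift C M"
    and flip_lift_coherence: "M \<in> obj C \<Longrightarrow>
      Tflip C (TO C M) \<cdot> TA C (Tflip C M) \<cdot> Tlift C (TO C M) = TA C (Tlift C M) \<cdot> Tflip C M"
    and lift_universal: "M \<in> obj C \<Longrightarrow>
      is_equaliser C (Tmu C M) (TA C (Tproj C M)) (Tzero C M \<cdot> Tproj C M \<cdot> Tproj C (TO C M))"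

locale tangent_category_with_negatives = tangent_category C
  for C :: "('o, 'a, 'x) tangent_data_scheme" (structure) +
  assumes negatives: "M \<in> obj C \<Longrightarrow> has_negation C (TO C M) (tangent_bundle C M)"


section \<open>Groupoids in a tangent category and their anchored bundles\<close>

context
  fixes C :: "('o, 'a, 'x) tangent_data_scheme" (structure)
begin

text \<open>A limit is preserved when its image under every iterate of \<open>T\<close> is again a limit; the case
  \<open>k = 0\<close> says that it is a limit to begin with.\<close>

definition preserved_pullback :: "'a \<Rightarrow> 'a \<Rightarrow> 'o \<Rightarrow> 'a \<Rightarrow> 'a \<Rightarrow> bool" where
  "preserved_pullback f g P a b \<longleftrightarrow>
    (\<forall>k. is_pullback C ((TA C ^^ k) f) ((TA C ^^ k) g) ((TO C ^^ k) P)
      ((TA C ^^ k) a) ((TA C ^^ k) b))"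

definition preserved_product :: "'o \<Rightarrow> 'o \<Rightarrow> 'o \<Rightarrow> 'a \<Rightarrow> 'a \<Rightarrow> bool" where
  "preserved_product X Y P a b \<longleftrightarrow>
    (\<forall>k. is_product C ((TO C ^^ k) X) ((TO C ^^ k) Y) ((TO C ^^ k) P)
      ((TA C ^^ k) a) ((TA C ^^ k) b))"

text \<open>The limits used by a groupoid are the objects of composable pairs and of composable triples;
  the latter is the pullback of \<open>(g, h) \<mapsto> h\<close> and \<open>(h, k) \<mapsto> h\<close>.\<close>

definition tangent_groupoid :: "('o, 'a) groupoid_data \<Rightarrow> bool" where
  "tangent_groupoid G \<longleftrightarrow>
    internal_groupoid C G \<and>
    preserved_pullback (gsrc G) (gtgt G) (gpairs G) (gfst G) (gsnd G) \<and>
    (\<exists>Q a b. preserved_pullback (gsnd G) (gfst G) Q a b)"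

definition T_groupoid :: "('o, 'a) groupoid_data \<Rightarrow> ('o, 'a) groupoid_data" where
  "T_groupoid G = \<lparr>gobj = TO C (gobj G), garr = TO C (garr G), gid = TA C (gid G),
    gsrc = TA C (gsrc G), gtgt = TA C (gtgt G), ginv = TA C (ginv G),
    gpairs = TO C (gpairs G), gfst = TA C (gfst G), gsnd = TA C (gsnd G), gmult = TA C (gmult G)\<rparr>"

text \<open>\<open>A\<close> is the pullback of \<open>(p, T(s)) : T(G) \<rightarrow> G \<times> T(M)\<close> along \<open>(e, 0) : M \<rightarrow> G \<times> T(M)\<close>, for a
  product \<open>(Q, j, j')\<close> of \<open>G\<close> and \<open>T(M)\<close>.\<close>

definition associated_anchored_bundle ::
  "('o, 'a) groupoid_data \<Rightarrow> 'o \<Rightarrow> 'a \<Rightarrow> 'a \<Rightarrow> bool" where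
  "associated_anchored_bundle G A \<pi> \<iota> \<longleftrightarrow>
    (\<exists>Q j j'. preserved_product (garr G) (TO C (gobj G)) Q j j' \<and>
      preserved_pullback
        (pair C j j' (Tproj C (garr G)) (TA C (gsrc G)))
        (pair C j j' (gid G) (Tzero C (gobj G)))
        A \<iota> \<pi>)"

definition anchor :: "('o, 'a) groupoid_data \<Rightarrow> 'a \<Rightarrow> 'a" where
  "anchor G \<iota> = TA C (gtgt G) \<cdot> \<iota>"

text \<open>The lift \<open>\<lambda> : A \<rightarrow> T(A)\<close> is the restriction of the lift of \<open>T(G)\<close>: \<open>T(\<iota>) \<lambda> = l \<iota>\<close>.\<close>

definition anchored_lift :: "('o, 'a) groupoid_data \<Rightarrow> 'o \<Rightarrow> 'a \<Rightarrow> 'a" where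
  "anchored_lift G A \<iota> = (THE u. u \<in> hom C A (TO C A) \<and> TA C \<iota> \<cdot> u = Tlift C (garr G) \<cdot> \<iota>)"

definition prolongation ::
  "('o, 'a) groupoid_data \<Rightarrow> 'a \<Rightarrow> 'a \<Rightarrow> 'o \<Rightarrow> 'a \<Rightarrow> 'a \<Rightarrow> bool" where
  "prolongation G \<pi> \<iota> P \<pi>0 \<pi>1 \<longleftrightarrow> preserved_pullback (anchor G \<iota>) (TA C \<pi>) P \<pi>0 \<pi>1"

text \<open>The lift \<open>0 \<times> c T(\<lambda>) : P \<rightarrow> T(P)\<close>.\<close>

definition prolongation_lift ::
  "('o, 'a) groupoid_data \<Rightarrow> 'o \<Rightarrow> 'a \<Rightarrow> 'a \<Rightarrow> 'a \<Rightarrow> 'a" where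
  "prolongation_lift G A \<iota> \<pi>0 \<pi>1 = pair C (TA C \<pi>0) (TA C \<pi>1)
    (Tzero C A \<cdot> \<pi>0) (Tflip C A \<cdot> TA C (anchored_lift G A \<iota>) \<cdot> \<pi>1)"

text \<open>\<open>c w \<circ> 0 v \<circ> (c 0 p w)\<inverse>\<close> in \<open>T\<^sup>2(G)\<close>, for generalised elements \<open>v\<close> of \<open>T(G)\<close> and \<open>w\<close> of \<open>T\<^sup>2(G)\<close>;
  the triple composite is bracketed to the left.\<close>

definition alpha_composite :: "('o, 'a) groupoid_data \<Rightarrow> 'a \<Rightarrow> 'a \<Rightarrow> 'a" where
  "alpha_composite G v w =
    (let GG = T_groupoid (T_groupoid G); TG = TO C (garr G); c = Tflip C (garr G) in
      gcomp C GG
        (gcomp C GG (c \<cdot> w) (Tzero C TG \<cdot> v))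
        (ginv GG \<cdot> (c \<cdot> (Tzero C TG \<cdot> (Tproj C TG \<cdot> w)))))"

text \<open>\<open>\<alpha> : P \<rightarrow> T(A)\<close>, where \<open>A\<close> and \<open>T(A)\<close> are regarded as subobjects of \<open>T(G)\<close> and \<open>T\<^sup>2(G)\<close> along
  \<open>\<iota>\<close> and \<open>T(\<iota>)\<close>.\<close>

definition alpha :: "('o, 'a) groupoid_data \<Rightarrow> 'o \<Rightarrow> 'a \<Rightarrow> 'o \<Rightarrow> 'a \<Rightarrow> 'a \<Rightarrow> 'a" where
  "alpha G A \<iota> P \<pi>0 \<pi>1 = (THE u. u \<in> hom C P (TO C A) \<and>
    TA C \<iota> \<cdot> u = alpha_composite G (\<iota> \<cdot> \<pi>0) (TA C \<iota> \<cdot> \<pi>1))"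

text \<open>\<open>\<phi>1\<close> is a linear bundle morphism over \<open>\<phi>0\<close> from \<open>q : E \<rightarrow> M\<close> with lift \<open>\<lambda>\<close> to \<open>q' : E' \<rightarrow> M'\<close> with
  lift \<open>\<lambda>'\<close>.\<close>

definition linear_bundle_morphism ::
  "'o \<Rightarrow> 'o \<Rightarrow> 'a \<Rightarrow> 'a \<Rightarrow> 'o \<Rightarrow> 'o \<Rightarrow> 'a \<Rightarrow> 'a \<Rightarrow> 'a \<Rightarrow> 'a \<Rightarrow> bool" where
  "linear_bundle_morphism E M q lam E' M' q' lam' \<phi>0 \<phi>1 \<longleftrightarrow>
    q \<in> hom C E M \<and> lam \<in> hom C E (TO C E) \<and>
    q' \<in> hom C E' M' \<and> lam' \<in> hom C E' (TO C E') \<and>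
    \<phi>0 \<in> hom C M M' \<and> \<phi>1 \<in> hom C E E' \<and>
    q' \<cdot> \<phi>1 = \<phi>0 \<cdot> q \<and>
    TA C \<phi>1 \<cdot> lam = lam' \<cdot> \<phi>1"

end

end

theory Submission
  imports Defs
begin

text \<open>
  Write \<open>v\<close> and \<open>w\<close> for the two components of a generalised element of the prolongation, seen in
  \<open>T(G)\<close> and \<open>T\<^sup>2(G)\<close>. The composite \<open>\<alpha>(v, w)\<close> is formed in the groupoid \<open>T\<^sup>2(G)\<close>, and every
  natural transformation between powers of \<open>T\<close>, as well as every power of \<open>T\<close> applied to one, is a
  morphism of groupoids between the corresponding images of \<open>G\<close>. Hence \<open>T(p)\<close>, \<open>p\<close> and \<open>l\<close> may be
  applied to \<open>\<alpha>(v, w)\<close> factor by factor. Since \<open>c0 = T(0)\<close>, the last factor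
  \<open>(c0pw)\<inverse>\<close> is \<open>T(0)(pw)\<inverse>\<close>, with the inverse taken in \<open>T(G)\<close>.

  \<^item> Under \<open>T(p)\<close> the factors become \<open>pw\<close>, an identity and \<open>(pw)\<inverse>\<close>, so the result is an identity;
    with the source of \<open>\<alpha>(v, w)\<close> this shows that it lies in \<open>T(A)\<close>
    (\<open>T_proj_alpha_composite\<close>, \<open>src_alpha_composite\<close>).
  \<^item> Under \<open>p\<close> they become an identity, \<open>v\<close> and an identity, so \<open>p\<alpha>(v, w) = v\<close>
    (\<open>proj_alpha_composite\<close>).
  \<^item> For linearity, \<open>T(\<alpha>)(0v, cT(\<lambda>)w)\<close> and \<open>l\<alpha>(v, w)\<close> are compared in \<open>T\<^sup>3(G)\<close>. Their factors
    agree by \<open>T(c)cT(l) = lc\<close>, \<open>T(0)0 = l0\<close> and \<open>T(p)cT(l) = pT(l) = lp\<close>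
    (\<open>alpha_composite_linear\<close>). The first of these is the coherence
    \<open>cT(c)l = T(l)c\<close> composed with \<open>c\<close> and \<open>T(c)\<close>, which are involutions.

  The groupoid laws are available in \<open>T(G)\<close> because \<open>T\<close> preserves the objects of composable pairs and
  triples (\<open>T_groupoid_tangent\<close>). The equations descend to \<open>A\<close>, \<open>T(A)\<close> and \<open>T\<^sup>2(A)\<close> since \<open>\<iota>\<close>,
  \<open>T(\<iota>)\<close> and \<open>T\<^sup>2(\<iota>)\<close> are monomorphisms.
\<close>


section \<open>Arrows, pullbacks and products\<close>

text \<open>Typing is expressed by source and target equations rather than by membership in hom-sets, so
  that the simplifier can discharge the side conditions of associativity and bracket composites to
  the right.\<close>

context category
begin

lemma src_obj [simp]: "f \<in> arr C \<Longrightarrow> src C f \<in> obj C"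
  and tgt_obj [simp]: "f \<in> arr C \<Longrightarrow> tgt C f \<in> obj C"
  by (fact src_in_obj tgt_in_obj)+

lemma ident_arr [simp]:
  assumes "X \<in> obj C"
  shows "ident C X \<in> arr C" "src C (ident C X) = X" "tgt C (ident C X) = X"
  using ident_in_hom[OF assms] by (auto simp: hom_def)

lemma comp_arr [simp]:
  assumes "f \<in> arr C" "g \<in> arr C" "tgt C f = src C g"
  shows "g \<cdot> f \<in> arr C" "src C (g \<cdot> f) = src C f" "tgt C (g \<cdot> f) = tgt C g"
  using comp_in_hom[of f "src C f" "tgt C f" g "tgt C g"] assms by (auto simp: hom_def)

lemma assoc [simp]:
  assumes "f \<in> arr C" "g \<in> arr C" "h \<in> arr C" "tgt C f = src C g" "tgt C g = src C h"
  shows "(h \<cdot> g) \<cdot> f = h \<cdot> (g \<cdot> f)"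
  using comp_assoc[of f "src C f" "tgt C f" g "tgt C g" h "tgt C h"] assms by (auto simp: hom_def)

lemma ident_comp [simp]:
  "f \<in> arr C \<Longrightarrow> src C f = X \<Longrightarrow> f \<cdot> ident C X = f"
  "f \<in> arr C \<Longrightarrow> tgt C f = X \<Longrightarrow> ident C X \<cdot> f = f"
  using comp_ident_right comp_ident_left by (auto simp: hom_def)

text \<open>The form in which an equation between composites applies inside a right-bracketed composite.\<close>

lemma comp_cong_assoc:
  assumes "g \<cdot> f = k" "f \<in> arr C" "g \<in> arr C" "tgt C f = src C g" "x \<in> arr C" "tgt C x = src C f"
  shows "g \<cdot> (f \<cdot> x) = k \<cdot> x"
  using assms(1) assoc[OF assms(5,2,3,6,4)] by simp

lemma is_pullbackD:
  assumes "is_pullback C f g P a b"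
  shows "f \<in> arr C" "g \<in> arr C" "a \<in> arr C" "b \<in> arr C"
    "src C a = P" "src C b = P" "tgt C a = src C f" "tgt C b = src C g" "tgt C g = tgt C f"
    "f \<cdot> a = g \<cdot> b"
  using assms by (auto simp: is_pullback_def hom_def)

lemma is_pullback_universal:
  assumes "is_pullback C f g P a b" "x \<in> arr C" "y \<in> arr C" "src C x = src C y"
    "tgt C x = src C f" "tgt C y = src C g" "f \<cdot> x = g \<cdot> y"
  shows "\<exists>!u. u \<in> hom C (src C x) P \<and> a \<cdot> u = x \<and> b \<cdot> u = y"
proof -
  obtain X Y Z where XY: "f \<in> hom C X Z" "g \<in> hom C Y Z"
    and univ: "\<And>W x y. x \<in> hom C W X \<Longrightarrow> y \<in> hom C W Y \<Longrightarrow> f \<cdot> x = g \<cdot> y \<Longrightarrow>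
      \<exists>!u. u \<in> hom C W P \<and> a \<cdot> u = x \<and> b \<cdot> u = y"
    using assms(1) unfolding is_pullback_def by (elim exE conjE) (erule (1) that, blast)
  have "x \<in> hom C (src C x) X" "y \<in> hom C (src C x) Y"
    using XY assms(2-6) by (auto simp: hom_def)
  then show ?thesis
    using univ assms(7) by blast
qed

lemma pair_pullback:
  assumes "is_pullback C f g P a b" "x \<in> arr C" "y \<in> arr C" "src C x = src C y"
    "tgt C x = src C f" "tgt C y = src C g" "f \<cdot> x = g \<cdot> y"
  shows "pair C a b x y \<in> arr C" "src C (pair C a b x y) = src C x"
    "tgt C (pair C a b x y) = P" "a \<cdot> pair C a b x y = x" "b \<cdot> pair C a b x y = y"
  using theI'[OF is_pullback_universal[OF assms]] is_pullbackD(5)[OF assms(1)]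
  by (auto simp: pair_def hom_def)

lemma pullback_eqI:
  assumes "is_pullback C f g P a b" "u \<in> arr C" "u' \<in> arr C" "src C u = src C u'"
    "tgt C u = P" "tgt C u' = P" "a \<cdot> u = a \<cdot> u'" "b \<cdot> u = b \<cdot> u'"
  shows "u = u'"
proof -
  note pb = is_pullbackD[OF assms(1)]
  have "f \<cdot> (a \<cdot> u) = g \<cdot> (b \<cdot> u)"
    using pb(1-9) assms(2,5) by (simp add: comp_cong_assoc[OF pb(10)])
  then have "\<exists>!z. z \<in> hom C (src C (a \<cdot> u)) P \<and> a \<cdot> z = a \<cdot> u \<and> b \<cdot> z = b \<cdot> u"
    using pb assms by (intro is_pullback_universal) auto
  then show ?thesis
    using assms pb by (auto simp: hom_def)
qed

lemma pair_eqI: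
  assumes "is_pullback C f g P a b" "u \<in> arr C" "tgt C u = P" "a \<cdot> u = x" "b \<cdot> u = y"
  shows "pair C a b x y = u"
proof -
  note pb = is_pullbackD[OF assms(1)]
  have eq: "f \<cdot> x = g \<cdot> y"
    unfolding assms(4,5)[symmetric]
    using pb(1-9) assms(2,3) by (simp add: comp_cong_assoc[OF pb(10)])
  have xy: "x \<in> arr C" "y \<in> arr C" "src C x = src C u" "src C y = src C u"
    "tgt C x = src C f" "tgt C y = src C g"
    using pb assms(2,3) assms(4,5)[symmetric] by auto
  have "src C x = src C y"
    by (simp add: xy)
  note Q = pair_pullback[OF assms(1) xy(1,2) this xy(5,6) eq]
  show ?thesis
    by (rule pullback_eqI[OF assms(1)]) (simp_all add: Q xy assms(2-5))
qed

lemma pair_comp: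
  assumes "is_pullback C f g P a b" "x \<in> arr C" "y \<in> arr C" "src C x = src C y"
    "tgt C x = src C f" "tgt C y = src C g" "f \<cdot> x = g \<cdot> y" "z \<in> arr C" "tgt C z = src C x"
  shows "pair C a b (x \<cdot> z) (y \<cdot> z) = pair C a b x y \<cdot> z"
  by (rule pair_eqI[OF assms(1)])
    (use pair_pullback[OF assms(1-7)] is_pullbackD[OF assms(1)] assms in
      \<open>simp_all add: assoc[symmetric] del: assoc\<close>)

lemma pair_product:
  assumes "is_product C X Y Q a b" "x \<in> arr C" "y \<in> arr C" "src C x = src C y"
    "tgt C x = X" "tgt C y = Y"
  shows "pair C a b x y \<in> arr C" "src C (pair C a b x y) = src C x"
    "tgt C (pair C a b x y) = Q" "a \<cdot> pair C a b x y = x" "b \<cdot> pair C a b x y = y"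
proof -
  have "x \<in> hom C (src C x) X" "y \<in> hom C (src C x) Y"
    using assms(2-6) by (simp_all add: hom_def)
  then have "\<exists>!u. u \<in> hom C (src C x) Q \<and> a \<cdot> u = x \<and> b \<cdot> u = y"
    using assms(1) unfolding is_product_def by blast
  moreover have srca: "src C a = Q"
    using assms(1) unfolding is_product_def hom_def by blast
  ultimately show "pair C a b x y \<in> arr C" "src C (pair C a b x y) = src C x"
    "tgt C (pair C a b x y) = Q" "a \<cdot> pair C a b x y = x" "b \<cdot> pair C a b x y = y"
    using theI'[of "\<lambda>u. u \<in> hom C (src C x) Q \<and> a \<cdot> u = x \<and> b \<cdot> u = y"]
    by (simp_all add: pair_def hom_def)
qed

lemma product_eqI:
  assumes "is_product C X Y Q a b" "u \<in> arr C" "u' \<in> arr C" "src C u = src C u'"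
    "tgt C u = Q" "tgt C u' = Q" "a \<cdot> u = a \<cdot> u'" "b \<cdot> u = b \<cdot> u'"
  shows "u = u'"
proof -
  have "a \<in> hom C Q X" "b \<in> hom C Q Y"
    using assms(1) unfolding is_product_def by blast+
  then have "a \<cdot> u \<in> hom C (src C u) X" "b \<cdot> u \<in> hom C (src C u) Y"
    using assms by (auto simp: hom_def)
  then have "\<exists>!z. z \<in> hom C (src C u) Q \<and> a \<cdot> z = a \<cdot> u \<and> b \<cdot> z = b \<cdot> u"
    using assms(1) unfolding is_product_def by blast
  then show ?thesis
    using assms by (auto simp: hom_def)
qed

section \<open>Internal groupoids\<close>

lemma internal_groupoidD:
  assumes "internal_groupoid C H"
  shows "gid H \<in> hom C (gobj H) (garr H)"
    "gsrc H \<in> hom C (garr H) (gobj H)" "gtgt H \<in> hom C (garr H) (gobj H)"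
    "ginv H \<in> hom C (garr H) (garr H)" "gmult H \<in> hom C (gpairs H) (garr H)"
    and internal_groupoid_pairs: "is_pullback C (gsrc H) (gtgt H) (gpairs H) (gfst H) (gsnd H)"
    and internal_groupoid_eqs: "gsrc H \<cdot> gid H = ident C (gobj H)"
    "gtgt H \<cdot> gid H = ident C (gobj H)" "gsrc H \<cdot> gmult H = gsrc H \<cdot> gsnd H"
    "gtgt H \<cdot> gmult H = gtgt H \<cdot> gfst H" "gsrc H \<cdot> ginv H = gtgt H" "gtgt H \<cdot> ginv H = gsrc H"
  using assms unfolding internal_groupoid_def by - (elim conjE, assumption)+

lemma internal_groupoid_arr:
  assumes "internal_groupoid C H"
  shows "gid H \<in> arr C" "src C (gid H) = gobj H" "tgt C (gid H) = garr H"
    "gsrc H \<in> arr C" "src C (gsrc H) = garr H" "tgt C (gsrc H) = gobj H"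
    "gtgt H \<in> arr C" "src C (gtgt H) = garr H" "tgt C (gtgt H) = gobj H"
    "ginv H \<in> arr C" "src C (ginv H) = garr H" "tgt C (ginv H) = garr H"
    "gmult H \<in> arr C" "src C (gmult H) = gpairs H" "tgt C (gmult H) = garr H"
    "gfst H \<in> arr C" "src C (gfst H) = gpairs H" "tgt C (gfst H) = garr H"
    "gsnd H \<in> arr C" "src C (gsnd H) = gpairs H" "tgt C (gsnd H) = garr H"
    "gobj H \<in> obj C" "garr H \<in> obj C" "gpairs H \<in> obj C"
  using internal_groupoidD(1-5)[OF assms] is_pullbackD(1-9)[OF internal_groupoid_pairs[OF assms]]
    src_obj[of "gid H"] src_obj[of "gsrc H"] src_obj[of "gmult H"]
  by (simp_all add: hom_def)

text \<open>Two generalised elements of the object of arrows, with the same domain, such that \<open>g \<circ> h\<close> is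
  defined.\<close>

definition composable :: "('o, 'a) groupoid_data \<Rightarrow> 'a \<Rightarrow> 'a \<Rightarrow> bool" where
  "composable H g h \<longleftrightarrow> g \<in> arr C \<and> h \<in> arr C \<and> src C g = src C h \<and>
    tgt C g = garr H \<and> tgt C h = garr H \<and> gsrc H \<cdot> g = gtgt H \<cdot> h"

lemma composable_pair:
  assumes "internal_groupoid C H" "composable H g h"
  defines "z \<equiv> pair C (gfst H) (gsnd H) g h"
  shows "z \<in> arr C" "src C z = src C g" "tgt C z = gpairs H" "gfst H \<cdot> z = g" "gsnd H \<cdot> z = h"
  using pair_pullback[OF internal_groupoid_pairs[OF assms(1)], of g h] assms(2)
    internal_groupoid_arr[OF assms(1)]
  by (auto simp: composable_def z_def)

lemma gcomp_arr:
  assumes "internal_groupoid C H" "composable H g h"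
  shows "gcomp C H g h \<in> arr C" "src C (gcomp C H g h) = src C g"
    "tgt C (gcomp C H g h) = garr H"
    "gsrc H \<cdot> gcomp C H g h = gsrc H \<cdot> h" "gtgt H \<cdot> gcomp C H g h = gtgt H \<cdot> g"
proof -
  note [simp] = internal_groupoid_arr[OF assms(1)]
  note P = composable_pair[OF assms]
  note E = internal_groupoid_eqs[OF assms(1)]
  show "gcomp C H g h \<in> arr C" "src C (gcomp C H g h) = src C g"
    "tgt C (gcomp C H g h) = garr H"
    using P by (simp_all add: gcomp_def)
  show "gsrc H \<cdot> gcomp C H g h = gsrc H \<cdot> h"
    using P comp_cong_assoc[OF E(3)] by (simp add: gcomp_def)
  show "gtgt H \<cdot> gcomp C H g h = gtgt H \<cdot> g"
    using P comp_cong_assoc[OF E(4)] by (simp add: gcomp_def)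
qed

lemma gcomp_comp:
  assumes "internal_groupoid C H" "composable H g h" "z \<in> arr C" "tgt C z = src C g"
  shows "gcomp C H (g \<cdot> z) (h \<cdot> z) = gcomp C H g h \<cdot> z"
proof -
  note [simp] = internal_groupoid_arr[OF assms(1)]
  have "pair C (gfst H) (gsnd H) (g \<cdot> z) (h \<cdot> z) = pair C (gfst H) (gsnd H) g h \<cdot> z"
    by (rule pair_comp[OF internal_groupoid_pairs[OF assms(1)]])
      (use assms in \<open>auto simp: composable_def\<close>)
  then show ?thesis
    using composable_pair[OF assms(1,2)] assms(3,4) by (simp add: gcomp_def)
qed

text \<open>An arrow \<open>\<phi>\<close> between objects of arrows preserves composition as soon as it is covered by an
  arrow \<open>\<psi>\<close> between the objects of composable pairs that is compatible with both projections and with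
  the multiplications.\<close>

lemma gcomp_natural:
  assumes H: "internal_groupoid C H" and K: "internal_groupoid C K" and gh: "composable H g h"
    and \<phi>: "\<phi> \<in> arr C" "src C \<phi> = garr H" "tgt C \<phi> = garr K"
    and \<psi>: "\<psi> \<in> arr C" "src C \<psi> = gpairs H" "tgt C \<psi> = gpairs K"
    and eq: "gfst K \<cdot> \<psi> = \<phi> \<cdot> gfst H" "gsnd K \<cdot> \<psi> = \<phi> \<cdot> gsnd H" "gmult K \<cdot> \<psi> = \<phi> \<cdot> gmult H"
  shows "\<phi> \<cdot> gcomp C H g h = gcomp C K (\<phi> \<cdot> g) (\<phi> \<cdot> h)"
proof -
  note [simp] = internal_groupoid_arr[OF H] internal_groupoid_arr[OF K] \<phi> \<psi> composable_pair[OF H gh]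
  let ?z = "pair C (gfst H) (gsnd H) g h"
  have "pair C (gfst K) (gsnd K) (\<phi> \<cdot> g) (\<phi> \<cdot> h) = \<psi> \<cdot> ?z"
    by (rule pair_eqI[OF internal_groupoid_pairs[OF K]])
      (simp_all add: comp_cong_assoc[OF eq(1)] comp_cong_assoc[OF eq(2)])
  then show ?thesis
    by (simp add: gcomp_def comp_cong_assoc[OF eq(3)])
qed

lemma groupoid_laws:
  assumes "internal_groupoid C H" "g \<in> arr C" "tgt C g = garr H"
  shows "gcomp C H g (gid H \<cdot> (gsrc H \<cdot> g)) = g" "gcomp C H (gid H \<cdot> (gtgt H \<cdot> g)) g = g"
    "gcomp C H g (ginv H \<cdot> g) = gid H \<cdot> (gtgt H \<cdot> g)"
    "gcomp C H (ginv H \<cdot> g) g = gid H \<cdot> (gsrc H \<cdot> g)"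
proof -
  have "g \<in> hom C (src C g) (garr H)"
    using assms by (simp add: hom_def)
  then show "gcomp C H g (gid H \<cdot> (gsrc H \<cdot> g)) = g" "gcomp C H (gid H \<cdot> (gtgt H \<cdot> g)) g = g"
    "gcomp C H g (ginv H \<cdot> g) = gid H \<cdot> (gtgt H \<cdot> g)"
    "gcomp C H (ginv H \<cdot> g) g = gid H \<cdot> (gsrc H \<cdot> g)"
    using assms(1) unfolding internal_groupoid_def by blast+
qed

lemma ginv_gid:
  assumes "internal_groupoid C H" "m \<in> arr C" "tgt C m = gobj H"
  shows "ginv H \<cdot> (gid H \<cdot> m) = gid H \<cdot> m"
proof -
  note [simp] = internal_groupoid_arr[OF assms(1)] assms(2,3)
  note E = internal_groupoid_eqs[OF assms(1)]
  note [simp] = comp_cong_assoc[OF E(2)] comp_cong_assoc[OF E(6)] comp_cong_assoc[OF E(1)]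
  have "gcomp C H (gid H \<cdot> m) (ginv H \<cdot> (gid H \<cdot> m)) = gid H \<cdot> m"
    using groupoid_laws(3)[OF assms(1), of "gid H \<cdot> m"] by simp
  moreover have "gcomp C H (gid H \<cdot> m) (ginv H \<cdot> (gid H \<cdot> m)) = ginv H \<cdot> (gid H \<cdot> m)"
    using groupoid_laws(2)[OF assms(1), of "ginv H \<cdot> (gid H \<cdot> m)"] by simp
  ultimately show ?thesis by simp
qed

end


section \<open>Equations in a tangent category\<close>

context tangent_category
begin

lemma TO_obj [simp]: "X \<in> obj C \<Longrightarrow> TO C X \<in> obj C"
  using T_functor by (simp add: endofunctor_def)

lemma TA_arr [simp]:
  assumes "f \<in> arr C"
  shows "TA C f \<in> arr C" "src C (TA C f) = TO C (src C f)" "tgt C (TA C f) = TO C (tgt C f)"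
proof -
  have "TA C f \<in> hom C (TO C (src C f)) (TO C (tgt C f))"
    using T_functor assms by (auto simp: endofunctor_def hom_def)
  then show "TA C f \<in> arr C" "src C (TA C f) = TO C (src C f)" "tgt C (TA C f) = TO C (tgt C f)"
    by (auto simp: hom_def)
qed

lemma TA_comp [simp]:
  "f \<in> arr C \<Longrightarrow> g \<in> arr C \<Longrightarrow> tgt C f = src C g \<Longrightarrow> TA C (g \<cdot> f) = TA C g \<cdot> TA C f"
  using T_functor by (auto simp: endofunctor_def hom_def)

lemma TA_square:
  assumes "g \<cdot> f = k \<cdot> h" "f \<in> arr C" "g \<in> arr C" "h \<in> arr C" "k \<in> arr C"
    "tgt C f = src C g" "tgt C h = src C k"
  shows "TA C g \<cdot> TA C f = TA C k \<cdot> TA C h"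
  using arg_cong[OF assms(1), of "TA C"] assms(2-7) by simp

lemma TA_ident [simp]: "X \<in> obj C \<Longrightarrow> TA C (ident C X) = ident C (TO C X)"
  using T_functor by (simp add: endofunctor_def)

lemma structure_arr [simp]:
  assumes "X \<in> obj C"
  shows "Tproj C X \<in> arr C" "src C (Tproj C X) = TO C X" "tgt C (Tproj C X) = X"
    "Tzero C X \<in> arr C" "src C (Tzero C X) = X" "tgt C (Tzero C X) = TO C X"
    "Tlift C X \<in> arr C" "src C (Tlift C X) = TO C X" "tgt C (Tlift C X) = TO C (TO C X)"
    "Tflip C X \<in> arr C" "src C (Tflip C X) = TO C (TO C X)" "tgt C (Tflip C X) = TO C (TO C X)"
  using proj_natural zero_natural lift_natural flip_natural assms
  by (auto simp: natural_transformation_def hom_def)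

lemma natural:
  assumes "f \<in> arr C"
  shows "Tproj C (tgt C f) \<cdot> TA C f = f \<cdot> Tproj C (src C f)"
    "Tzero C (tgt C f) \<cdot> f = TA C f \<cdot> Tzero C (src C f)"
    "Tlift C (tgt C f) \<cdot> TA C f = TA C (TA C f) \<cdot> Tlift C (src C f)"
    "Tflip C (tgt C f) \<cdot> TA C (TA C f) = TA C (TA C f) \<cdot> Tflip C (src C f)"
  using proj_natural zero_natural lift_natural flip_natural assms
  by (auto simp: natural_transformation_def hom_def)

lemma natural_at:
  assumes "f \<in> arr C" "tgt C f = Y" "x \<in> arr C"
  shows "tgt C x = TO C (src C f) \<Longrightarrow>
      Tproj C Y \<cdot> (TA C f \<cdot> x) = f \<cdot> (Tproj C (src C f) \<cdot> x)"
    "tgt C x = src C f \<Longrightarrow> Tzero C Y \<cdot> (f \<cdot> x) = TA C f \<cdot> (Tzero C (src C f) \<cdot> x)"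
    "tgt C x = TO C (src C f) \<Longrightarrow>
      Tlift C Y \<cdot> (TA C f \<cdot> x) = TA C (TA C f) \<cdot> (Tlift C (src C f) \<cdot> x)"
    "tgt C x = TO C (TO C (src C f)) \<Longrightarrow>
      Tflip C Y \<cdot> (TA C (TA C f) \<cdot> x) = TA C (TA C f) \<cdot> (Tflip C (src C f) \<cdot> x)"
  using comp_cong_assoc[OF natural(1)[OF assms(1)], of x]
    comp_cong_assoc[OF natural(2)[OF assms(1)], of x]
    comp_cong_assoc[OF natural(3)[OF assms(1)], of x]
    comp_cong_assoc[OF natural(4)[OF assms(1)], of x] assms
  by auto

text \<open>The zero and projection parts of the axioms that \<open>p\<close> is an additive bundle and that \<open>l\<close> and \<open>c\<close>
  are additive bundle morphisms, with their consequences for the involution \<open>c\<close>. The last equation is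
  \<open>T(c)cT(l) = lc\<close>.\<close>

lemma structure_eqs:
  assumes "X \<in> obj C"
  shows "Tproj C X \<cdot> Tzero C X = ident C X"
    "TA C (Tproj C X) \<cdot> Tlift C X = Tzero C X \<cdot> Tproj C X"
    "Tlift C X \<cdot> Tzero C X = TA C (Tzero C X) \<cdot> Tzero C X"
    "Tproj C (TO C X) \<cdot> Tflip C X = TA C (Tproj C X)"
    "Tflip C X \<cdot> TA C (Tzero C X) = Tzero C (TO C X)"
    "TA C (Tproj C X) \<cdot> Tflip C X = Tproj C (TO C X)"
    "Tflip C X \<cdot> Tzero C (TO C X) = TA C (Tzero C X)"
    "TA C (Tflip C X) \<cdot> (Tflip C (TO C X) \<cdot> TA C (Tlift C X)) = Tlift C (TO C X) \<cdot> Tflip C X"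
proof -
  note [simp] = assms
  note F = flip_flip[OF assms]
  show 1: "Tproj C X \<cdot> Tzero C X = ident C X"
    using tangent_additive[OF assms] by (simp add: additive_bundle_def tangent_bundle_def)
  show "TA C (Tproj C X) \<cdot> Tlift C X = Tzero C X \<cdot> Tproj C X"
    "Tlift C X \<cdot> Tzero C X = TA C (Tzero C X) \<cdot> Tzero C X"
    using lift_additive[OF assms]
    by (auto simp: additive_bundle_morphism_def tangent_bundle_def T_bundle_def)
  show 2: "Tproj C (TO C X) \<cdot> Tflip C X = TA C (Tproj C X)"
    and 3: "Tflip C X \<cdot> TA C (Tzero C X) = Tzero C (TO C X)"
    using flip_additive[OF assms]
    by (auto simp: additive_bundle_morphism_def tangent_bundle_def T_bundle_def)
  show "TA C (Tproj C X) \<cdot> Tflip C X = Tproj C (TO C X)"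
    by (simp add: 2[symmetric] F)
  show "Tflip C X \<cdot> Tzero C (TO C X) = TA C (Tzero C X)"
    by (simp add: 3[symmetric] comp_cong_assoc[OF F])
  have F': "TA C (Tflip C X) \<cdot> TA C (Tflip C X) = ident C (TO C (TO C (TO C X)))"
    using arg_cong[OF F, of "TA C"] by simp
  have L: "Tflip C (TO C X) \<cdot> (TA C (Tflip C X) \<cdot> Tlift C (TO C X)) = TA C (Tlift C X) \<cdot> Tflip C X"
    using flip_lift_coherence[OF assms] by simp
  have "TA C (Tlift C X) = (TA C (Tlift C X) \<cdot> Tflip C X) \<cdot> Tflip C X"
    by (simp add: F)
  also have "\<dots> = Tflip C (TO C X) \<cdot> (TA C (Tflip C X) \<cdot> (Tlift C (TO C X) \<cdot> Tflip C X))"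
    unfolding L[symmetric] by simp
  finally show "TA C (Tflip C X) \<cdot> (Tflip C (TO C X) \<cdot> TA C (Tlift C X)) =
      Tlift C (TO C X) \<cdot> Tflip C X"
    by (simp add: comp_cong_assoc[OF flip_flip[of "TO C X"]] comp_cong_assoc[OF F'])
qed

lemma structure_eqs_at:
  assumes "X \<in> obj C" "x \<in> arr C"
  shows "tgt C x = X \<Longrightarrow> Tproj C X \<cdot> (Tzero C X \<cdot> x) = x"
    "tgt C x = TO C X \<Longrightarrow> TA C (Tproj C X) \<cdot> (Tlift C X \<cdot> x) = Tzero C X \<cdot> (Tproj C X \<cdot> x)"
    "tgt C x = X \<Longrightarrow> Tlift C X \<cdot> (Tzero C X \<cdot> x) = TA C (Tzero C X) \<cdot> (Tzero C X \<cdot> x)"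
    "tgt C x = TO C (TO C X) \<Longrightarrow> Tproj C (TO C X) \<cdot> (Tflip C X \<cdot> x) = TA C (Tproj C X) \<cdot> x"
    "tgt C x = TO C X \<Longrightarrow> Tflip C X \<cdot> (TA C (Tzero C X) \<cdot> x) = Tzero C (TO C X) \<cdot> x"
    "tgt C x = TO C (TO C X) \<Longrightarrow> TA C (Tproj C X) \<cdot> (Tflip C X \<cdot> x) = Tproj C (TO C X) \<cdot> x"
    "tgt C x = TO C X \<Longrightarrow> Tflip C X \<cdot> (Tzero C (TO C X) \<cdot> x) = TA C (Tzero C X) \<cdot> x"
    "tgt C x = TO C (TO C X) \<Longrightarrow> TA C (Tflip C X) \<cdot> (Tflip C (TO C X) \<cdot> (TA C (Tlift C X) \<cdot> x)) =
      Tlift C (TO C X) \<cdot> (Tflip C X \<cdot> x)"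
  using comp_cong_assoc[OF structure_eqs(1)[OF assms(1)], of x]
    comp_cong_assoc[OF structure_eqs(2)[OF assms(1)], of x]
    comp_cong_assoc[OF structure_eqs(3)[OF assms(1)], of x]
    comp_cong_assoc[OF structure_eqs(4)[OF assms(1)], of x]
    comp_cong_assoc[OF structure_eqs(5)[OF assms(1)], of x]
    comp_cong_assoc[OF structure_eqs(6)[OF assms(1)], of x]
    comp_cong_assoc[OF structure_eqs(7)[OF assms(1)], of x]
    comp_cong_assoc[OF structure_eqs(8)[OF assms(1)], of x] assms
  by auto

lemma T_zero_natural_at:
  assumes "f \<in> arr C" "x \<in> arr C" "tgt C x = TO C (src C f)"
  shows "TA C (TA C f) \<cdot> (TA C (Tzero C (src C f)) \<cdot> x) = TA C (Tzero C (tgt C f)) \<cdot> (TA C f \<cdot> x)"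
  using comp_cong_assoc[OF TA_square[OF natural(2)[OF assms(1)]], of x] assms by simp

section \<open>The image of a groupoid under the tangent functor\<close>

lemma T_groupoid_sel [simp]:
  "gobj (T_groupoid C H) = TO C (gobj H)" "garr (T_groupoid C H) = TO C (garr H)"
  "gid (T_groupoid C H) = TA C (gid H)" "gsrc (T_groupoid C H) = TA C (gsrc H)"
  "gtgt (T_groupoid C H) = TA C (gtgt H)" "ginv (T_groupoid C H) = TA C (ginv H)"
  "gpairs (T_groupoid C H) = TO C (gpairs H)" "gfst (T_groupoid C H) = TA C (gfst H)"
  "gsnd (T_groupoid C H) = TA C (gsnd H)" "gmult (T_groupoid C H) = TA C (gmult H)"
  by (simp_all add: T_groupoid_def)

lemma preserved_pullbackD:
  "preserved_pullback C f g P a b \<Longrightarrow> is_pullback C f g P a b"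
  "preserved_pullback C f g P a b \<Longrightarrow>
    preserved_pullback C (TA C f) (TA C g) (TO C P) (TA C a) (TA C b)"
proof -
  assume *: "preserved_pullback C f g P a b"
  show "is_pullback C f g P a b"
    using *[unfolded preserved_pullback_def, rule_format, of 0] by simp
  show "preserved_pullback C (TA C f) (TA C g) (TO C P) (TA C a) (TA C b)"
    unfolding preserved_pullback_def
  proof
    fix k
    show "is_pullback C ((TA C ^^ k) (TA C f)) ((TA C ^^ k) (TA C g)) ((TO C ^^ k) (TO C P))
      ((TA C ^^ k) (TA C a)) ((TA C ^^ k) (TA C b))"
      using *[unfolded preserved_pullback_def, rule_format, of "Suc k"] by (simp add: funpow_swap1)
  qed
qed

lemma TA_pair:
  assumes pb: "is_pullback C f g P a b"
    and pb': "is_pullback C (TA C f) (TA C g) (TO C P) (TA C a) (TA C b)"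
    and "x \<in> arr C" "y \<in> arr C" "src C x = src C y"
    "tgt C x = src C f" "tgt C y = src C g" "f \<cdot> x = g \<cdot> y"
  shows "TA C (pair C a b x y) = pair C (TA C a) (TA C b) (TA C x) (TA C y)"
proof -
  note P = pair_pullback[OF pb assms(3-8)]
  note D = is_pullbackD[OF pb]
  have "TA C a \<cdot> TA C (pair C a b x y) = TA C x" "TA C b \<cdot> TA C (pair C a b x y) = TA C y"
    using P D(1-9) assms by (simp_all flip: TA_comp)
  then show ?thesis
    using P by (intro pair_eqI[OF pb', symmetric]) auto
qed

lemma TA_gcomp_pullback:
  assumes H: "internal_groupoid C H"
    and pb: "is_pullback C (TA C (gsrc H)) (TA C (gtgt H)) (TO C (gpairs H))
      (TA C (gfst H)) (TA C (gsnd H))"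
    and gh: "composable H g h"
  shows "TA C (gcomp C H g h) = gcomp C (T_groupoid C H) (TA C g) (TA C h)"
proof -
  note [simp] = internal_groupoid_arr[OF H]
  show ?thesis
    using TA_pair[OF internal_groupoid_pairs[OF H] pb, of g h] gh composable_pair[OF H gh]
    by (simp add: gcomp_def composable_def)
qed

lemma tangent_groupoid_internal: "tangent_groupoid C H \<Longrightarrow> internal_groupoid C H"
  by (simp add: tangent_groupoid_def)

text \<open>Each groupoid law is an equation between arrows out of a universal object: \<open>G\<close> itself for the
  unit and inverse laws, the object of composable triples for associativity. Applying \<open>T\<close> gives the
  law at the image of the universal element, and precomposition gives it at an arbitrary one.\<close>

lemma T_groupoid_tangent:
  assumes "tangent_groupoid C H"
  shows "tangent_groupoid C (T_groupoid C H)"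
proof -
  let ?K = "T_groupoid C H"
  have H: "internal_groupoid C H"
    and pp: "preserved_pullback C (gsrc H) (gtgt H) (gpairs H) (gfst H) (gsnd H)"
    using assms by (auto simp: tangent_groupoid_def)
  obtain Q a b where trip: "preserved_pullback C (gsnd H) (gfst H) Q a b"
    using assms by (auto simp: tangent_groupoid_def)
  note pp' = preserved_pullbackD(2)[OF pp]
  note pb = preserved_pullbackD(1)[OF pp]
  note pb' = preserved_pullbackD(1)[OF pp']
  note trip' = preserved_pullbackD(2)[OF trip]
  note tb = preserved_pullbackD(1)[OF trip]
  note tb' = preserved_pullbackD(1)[OF trip']
  note [simp] = internal_groupoid_arr[OF H]
  note E = internal_groupoid_eqs[OF H]
  note TE = E[THEN arg_cong[of _ _ "TA C"], simplified]
  have K_gcomp: "gcomp C ?K (x \<cdot> z) (y \<cdot> z) = gcomp C ?K x y \<cdot> z"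
    if "x \<in> arr C" "y \<in> arr C" "src C x = src C y" "tgt C x = TO C (garr H)"
      "tgt C y = TO C (garr H)" "TA C (gsrc H) \<cdot> x = TA C (gtgt H) \<cdot> y"
      "z \<in> arr C" "tgt C z = src C x" for x y z
    using pair_comp[OF pb', of x y z] pair_pullback[OF pb', of x y] that
    by (simp add: gcomp_def)
  \<comment> \<open>A law \<open>x \<circ> y = k\<close> at the universal element, transported to an arbitrary \<open>g\<close>.\<close>
  have T_law: "gcomp C ?K (TA C x \<cdot> g) (TA C y \<cdot> g) = TA C k \<cdot> g"
    if "gcomp C H x y = k" "composable H x y" "src C x = garr H"
      "g \<in> arr C" "tgt C g = TO C (garr H)" for x y k g
  proof -
    have xy: "x \<in> arr C" "y \<in> arr C" "src C y = garr H" "tgt C x = garr H" "tgt C y = garr H"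
      "gsrc H \<cdot> x = gtgt H \<cdot> y"
      using that by (auto simp: composable_def)
    have "TA C (gsrc H) \<cdot> TA C x = TA C (gtgt H) \<cdot> TA C y"
      using xy that(3) by (intro TA_square) simp_all
    then have "gcomp C ?K (TA C x \<cdot> g) (TA C y \<cdot> g) = gcomp C ?K (TA C x) (TA C y) \<cdot> g"
      using xy that by (intro K_gcomp) auto
    then show ?thesis
      using TA_gcomp_pullback[OF H pb' that(2)] that(1) by simp
  qed
  let ?i = "ident C (garr H)"
  have laws: "gcomp C H ?i (gid H \<cdot> gsrc H) = ?i" "gcomp C H (gid H \<cdot> gtgt H) ?i = ?i"
    "gcomp C H ?i (ginv H) = gid H \<cdot> gtgt H" "gcomp C H (ginv H) ?i = gid H \<cdot> gsrc H"
    using groupoid_laws[OF H, of ?i] by simp_all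
  have cp: "composable H ?i (gid H \<cdot> gsrc H)" "composable H (gid H \<cdot> gtgt H) ?i"
    "composable H ?i (ginv H)" "composable H (ginv H) ?i"
    using E by (simp_all add: composable_def comp_cong_assoc[OF E(1)] comp_cong_assoc[OF E(2)])
  have unit: "gcomp C ?K g (gid ?K \<cdot> (gsrc ?K \<cdot> g)) = g"
    "gcomp C ?K (gid ?K \<cdot> (gtgt ?K \<cdot> g)) g = g"
    "gcomp C ?K g (ginv ?K \<cdot> g) = gid ?K \<cdot> (gtgt ?K \<cdot> g)"
    "gcomp C ?K (ginv ?K \<cdot> g) g = gid ?K \<cdot> (gsrc ?K \<cdot> g)"
    if "g \<in> hom C W (garr ?K)" for W g
    using T_law[OF laws(1) cp(1), of g] T_law[OF laws(2) cp(2), of g]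
      T_law[OF laws(3) cp(3), of g] T_law[OF laws(4) cp(4), of g] that
    by (simp_all add: hom_def)
  have assoc: "gcomp C ?K (gcomp C ?K g h) k = gcomp C ?K g (gcomp C ?K h k)"
    if ghk: "g \<in> hom C W (garr ?K)" "h \<in> hom C W (garr ?K)" "k \<in> hom C W (garr ?K)"
      and eq: "gsrc ?K \<cdot> g = gtgt ?K \<cdot> h" "gsrc ?K \<cdot> h = gtgt ?K \<cdot> k" for W g h k
  proof -
    note D = is_pullbackD[OF tb]
    note [simp] = D(3-6)
    have ab [simp]: "tgt C a = gpairs H" "tgt C b = gpairs H"
      using D by auto
    \<comment> \<open>The universal composable triple.\<close>
    define x y z where "x = gfst H \<cdot> a" and "y = gsnd H \<cdot> a" and "z = gsnd H \<cdot> b"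
    have y': "y = gfst H \<cdot> b"
      using D(10) by (simp add: y_def)
    have xyz [simp]: "x \<in> arr C" "y \<in> arr C" "z \<in> arr C" "src C x = Q" "src C y = Q" "src C z = Q"
      "tgt C x = garr H" "tgt C y = garr H" "tgt C z = garr H"
      by (simp_all add: x_def y_def z_def)
    note M = is_pullbackD(10)[OF pb]
    have sx: "gsrc H \<cdot> x = gtgt H \<cdot> y"
      using comp_cong_assoc[OF M, of a] by (simp add: x_def y_def)
    have sy: "gsrc H \<cdot> y = gtgt H \<cdot> z"
      using comp_cong_assoc[OF M, of b] by (simp add: y' z_def)
    have c: "composable H x y" "composable H y z"
      using sx sy by (simp_all add: composable_def)
    have c': "composable H (gcomp C H x y) z" "composable H x (gcomp C H y z)"
      using gcomp_arr[OF H c(1)] gcomp_arr[OF H c(2)] sx sy by (simp_all add: composable_def)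
    have "gcomp C H (gcomp C H x y) z = gcomp C H x (gcomp C H y z)"
    proof -
      have "x \<in> hom C Q (garr H)" "y \<in> hom C Q (garr H)" "z \<in> hom C Q (garr H)"
        by (simp_all add: hom_def)
      then show ?thesis
        using H sx sy unfolding internal_groupoid_def by blast
    qed
    from arg_cong[OF this, of "TA C"]
    have T_assoc: "gcomp C ?K (gcomp C ?K (TA C x) (TA C y)) (TA C z) =
        gcomp C ?K (TA C x) (gcomp C ?K (TA C y) (TA C z))"
      by (simp add: TA_gcomp_pullback[OF H pb' c(1)] TA_gcomp_pullback[OF H pb' c(2)]
          TA_gcomp_pullback[OF H pb' c'(1)] TA_gcomp_pullback[OF H pb' c'(2)])
    have ghk' [simp]: "g \<in> arr C" "h \<in> arr C" "k \<in> arr C" "src C g = W" "src C h = W" "src C k = W"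
      "tgt C g = TO C (garr H)" "tgt C h = TO C (garr H)" "tgt C k = TO C (garr H)"
      using ghk by (simp_all add: hom_def)
    note gh = pair_pullback[OF pb', of g h, simplified, OF eq(1)[simplified]]
    note hk = pair_pullback[OF pb', of h k, simplified, OF eq(2)[simplified]]
    \<comment> \<open>The arrow into the image of the object of triples that classifies \<open>(g, h, k)\<close>.\<close>
    define u where "u = pair C (TA C a) (TA C b) (pair C (TA C (gfst H)) (TA C (gsnd H)) g h)
      (pair C (TA C (gfst H)) (TA C (gsnd H)) h k)"
    have u: "u \<in> arr C" "src C u = W" "tgt C u = TO C Q"
      "TA C a \<cdot> u = pair C (TA C (gfst H)) (TA C (gsnd H)) g h"
      "TA C b \<cdot> u = pair C (TA C (gfst H)) (TA C (gsnd H)) h k"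
      unfolding u_def using pair_pullback[OF tb'] gh hk by simp_all
    have gu: "g = TA C x \<cdot> u" "h = TA C y \<cdot> u" "k = TA C z \<cdot> u"
      using u gh hk by (simp_all add: x_def y_def z_def)
    have Tsx: "TA C (gsrc H) \<cdot> TA C x = TA C (gtgt H) \<cdot> TA C y"
      and Tsy: "TA C (gsrc H) \<cdot> TA C y = TA C (gtgt H) \<cdot> TA C z"
      using sx sy by (auto intro!: TA_square)
    have XY: "gcomp C ?K (TA C x) (TA C y) = TA C (gcomp C H x y)"
      and YZ: "gcomp C ?K (TA C y) (TA C z) = TA C (gcomp C H y z)"
      using TA_gcomp_pullback[OF H pb'] c by simp_all
    have XY_Z: "TA C (gsrc H) \<cdot> TA C (gcomp C H x y) = TA C (gtgt H) \<cdot> TA C z"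
      and X_YZ: "TA C (gsrc H) \<cdot> TA C x = TA C (gtgt H) \<cdot> TA C (gcomp C H y z)"
      using c' by (auto intro!: TA_square simp: composable_def)
    note A = gcomp_arr[OF H c(1)] gcomp_arr[OF H c(2)]
    have k1: "gcomp C ?K g h = gcomp C ?K (TA C x) (TA C y) \<cdot> u"
      unfolding gu using u Tsx by (intro K_gcomp) simp_all
    have k2: "gcomp C ?K h k = gcomp C ?K (TA C y) (TA C z) \<cdot> u"
      unfolding gu using u Tsy by (intro K_gcomp) simp_all
    have "gcomp C ?K (gcomp C ?K g h) k =
        gcomp C ?K (gcomp C ?K (TA C x) (TA C y)) (TA C z) \<cdot> u"
      unfolding k1 XY unfolding gu using u A XY_Z by (intro K_gcomp) simp_all
    also have "\<dots> = gcomp C ?K g (gcomp C ?K h k)"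
      unfolding T_assoc k2 YZ unfolding gu using u A X_YZ by (intro K_gcomp[symmetric]) simp_all
    finally show ?thesis .
  qed
  have "internal_groupoid C ?K"
    unfolding internal_groupoid_def
    using unit assoc pb' TE by (intro conjI allI ballI impI) (simp_all add: hom_def)
  then show ?thesis
    using pp' trip' by (auto simp: tangent_groupoid_def)
qed

lemma TA_gcomp:
  assumes "tangent_groupoid C H" "composable H g h"
  shows "TA C (gcomp C H g h) = gcomp C (T_groupoid C H) (TA C g) (TA C h)"
    and TA_composable: "composable (T_groupoid C H) (TA C g) (TA C h)"
proof -
  have H: "internal_groupoid C H"
    and "is_pullback C (TA C (gsrc H)) (TA C (gtgt H)) (TO C (gpairs H)) (TA C (gfst H)) (TA C (gsnd H))"
    using assms(1) preserved_pullbackD by (auto simp: tangent_groupoid_def)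
  then show "TA C (gcomp C H g h) = gcomp C (T_groupoid C H) (TA C g) (TA C h)"
    using TA_gcomp_pullback assms(2) by blast
  show "composable (T_groupoid C H) (TA C g) (TA C h)"
    using assms(2) internal_groupoid_arr[OF H] by (auto simp: composable_def intro!: TA_square)
qed

text \<open>The transformations \<open>p : T(H) \<rightarrow> H\<close>, \<open>T(p) : T\<^sup>2(H) \<rightarrow> T(H)\<close> and \<open>l : T(H) \<rightarrow> T\<^sup>2(H)\<close> preserve
  composition, being natural with respect to the structure arrows of \<open>H\<close>.\<close>

lemma gcomp_structure:
  assumes "tangent_groupoid C H"
  defines "K \<equiv> T_groupoid C H" and "L \<equiv> T_groupoid C (T_groupoid C H)"
  shows "composable K g h \<Longrightarrow> Tproj C (garr H) \<cdot> gcomp C K g h =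
      gcomp C H (Tproj C (garr H) \<cdot> g) (Tproj C (garr H) \<cdot> h)"
    and "composable L g h \<Longrightarrow> TA C (Tproj C (garr H)) \<cdot> gcomp C L g h =
      gcomp C K (TA C (Tproj C (garr H)) \<cdot> g) (TA C (Tproj C (garr H)) \<cdot> h)"
    and "composable K g h \<Longrightarrow> Tlift C (garr H) \<cdot> gcomp C K g h =
      gcomp C L (Tlift C (garr H) \<cdot> g) (Tlift C (garr H) \<cdot> h)"
proof -
  note K = T_groupoid_tangent[OF assms(1), folded K_def]
  note L = T_groupoid_tangent[OF K, unfolded K_def, folded L_def]
  note int = tangent_groupoid_internal[OF assms(1)] tangent_groupoid_internal[OF K]
    tangent_groupoid_internal[OF L]
  note [simp] = internal_groupoid_arr[OF int(1)]
  note N = natural[of "gfst H"] natural[of "gsnd H"] natural[of "gmult H"]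
  show "Tproj C (garr H) \<cdot> gcomp C K g h =
      gcomp C H (Tproj C (garr H) \<cdot> g) (Tproj C (garr H) \<cdot> h)" if "composable K g h"
    by (rule gcomp_natural[OF int(2,1) that, where \<psi> = "Tproj C (gpairs H)"])
      (use N in \<open>simp_all add: K_def\<close>)
  show "TA C (Tproj C (garr H)) \<cdot> gcomp C L g h =
      gcomp C K (TA C (Tproj C (garr H)) \<cdot> g) (TA C (Tproj C (garr H)) \<cdot> h)" if "composable L g h"
    by (rule gcomp_natural[OF int(3,2) that, where \<psi> = "TA C (Tproj C (gpairs H))"])
      (use N in \<open>auto simp: K_def L_def intro!: TA_square\<close>)
  show "Tlift C (garr H) \<cdot> gcomp C K g h =
      gcomp C L (Tlift C (garr H) \<cdot> g) (Tlift C (garr H) \<cdot> h)" if "composable K g h"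
    by (rule gcomp_natural[OF int(2,3) that, where \<psi> = "Tlift C (gpairs H)"])
      (use N in \<open>simp_all add: K_def L_def\<close>)
qed

end


section \<open>The composite defining \<open>\<alpha>\<close>\<close>

text \<open>A generalised element of the prolongation, with domain \<open>W\<close>, described by its underlying elements
  \<open>v\<close> of \<open>T(G)\<close> and \<open>w\<close> of \<open>T\<^sup>2(G)\<close>, together with their base points \<open>m = \<pi>v\<close> of \<open>M\<close> and
  \<open>y = T(\<pi>)w\<close> of \<open>T(M)\<close>. The condition \<open>\<varrho>v = T(\<pi>)w\<close> reads \<open>T(t)v = y\<close>.\<close>

locale prolongation_element = tangent_category C
  for C :: "('o, 'a, 'x) tangent_data_scheme" (structure) +
  fixes G :: "('o, 'a) groupoid_data" and W :: 'o and v w m y :: 'a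
  assumes G: "tangent_groupoid C G"
    and v [simp]: "v \<in> arr C" "src C v = W" "tgt C v = TO C (garr G)"
    and w [simp]: "w \<in> arr C" "src C w = W" "tgt C w = TO C (TO C (garr G))"
    and m [simp]: "m \<in> arr C" "src C m = W" "tgt C m = gobj G"
    and y [simp]: "y \<in> arr C" "src C y = W" "tgt C y = TO C (gobj G)"
    and proj_v: "Tproj C (garr G) \<cdot> v = gid G \<cdot> m"
    and src_v: "TA C (gsrc G) \<cdot> v = Tzero C (gobj G) \<cdot> m"
    and tgt_v: "TA C (gtgt G) \<cdot> v = y"
    and proj_w: "TA C (Tproj C (garr G)) \<cdot> w = TA C (gid G) \<cdot> y"
    and src_w: "TA C (TA C (gsrc G)) \<cdot> w = TA C (Tzero C (gobj G)) \<cdot> y"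
begin

abbreviation "TG \<equiv> T_groupoid C G"
abbreviation "TTG \<equiv> T_groupoid C TG"
abbreviation "TTTG \<equiv> T_groupoid C TTG"

text \<open>The inverse of \<open>pw\<close> in the groupoid \<open>T(G)\<close>.\<close>

definition "pw_inv = TA C (ginv G) \<cdot> (Tproj C (TO C (garr G)) \<cdot> w)"

lemma groupoids: "tangent_groupoid C TG" "tangent_groupoid C TTG"
  "internal_groupoid C G" "internal_groupoid C TG" "internal_groupoid C TTG"
  "internal_groupoid C TTTG"
  by (intro tangent_groupoid_internal T_groupoid_tangent G)+

lemmas G_arr [simp] = internal_groupoid_arr[OF groupoids(3)]

lemmas G_eqs = internal_groupoid_eqs[OF groupoids(3)]

lemma proj_y: "Tproj C (gobj G) \<cdot> y = m"
proof -
  have "Tproj C (gobj G) \<cdot> y = gtgt G \<cdot> (Tproj C (garr G) \<cdot> v)"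
    unfolding tgt_v[symmetric] by (simp add: natural_at)
  then show ?thesis
    by (simp add: proj_v comp_cong_assoc[OF G_eqs(2)])
qed

lemma zero_gid: "Tzero C (garr G) \<cdot> (gid G \<cdot> m) = TA C (gid G) \<cdot> (Tzero C (gobj G) \<cdot> m)"
  by (simp add: natural_at(2))

text \<open>\<open>T(s)pw = pT\<^sup>2(s)w = pT(0)y = 0py = 0m\<close>\<close>

lemma src_pw:
  "TA C (gsrc G) \<cdot> (Tproj C (TO C (garr G)) \<cdot> w) = Tzero C (gobj G) \<cdot> m"
proof -
  have "TA C (gsrc G) \<cdot> (Tproj C (TO C (garr G)) \<cdot> w) =
      Tproj C (TO C (gobj G)) \<cdot> (TA C (TA C (gsrc G)) \<cdot> w)"
    using natural_at(1)[of "TA C (gsrc G)" _ w] by simp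
  also have "\<dots> = Tzero C (gobj G) \<cdot> (Tproj C (gobj G) \<cdot> y)"
    using natural_at(1)[of "Tzero C (gobj G)" _ y] by (simp add: src_w)
  finally show ?thesis
    by (simp add: proj_y)
qed

lemma pw_inv [simp]: "pw_inv \<in> arr C" "src C pw_inv = W" "tgt C pw_inv = TO C (garr G)"
  by (simp_all add: pw_inv_def)

lemma src_pw_inv:
  "TA C (gsrc G) \<cdot> pw_inv = TA C (gtgt G) \<cdot> (Tproj C (TO C (garr G)) \<cdot> w)"
  unfolding pw_inv_def
  using comp_cong_assoc[OF internal_groupoid_eqs(5)[OF groupoids(4)]] by simp

lemma tgt_pw_inv: "TA C (gtgt G) \<cdot> pw_inv = Tzero C (gobj G) \<cdot> m"
  unfolding pw_inv_def
  using comp_cong_assoc[OF internal_groupoid_eqs(6)[OF groupoids(4)]] by (simp add: src_pw)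

text \<open>The third factor is rewritten by \<open>c0 = T(0)\<close> and the naturality of \<open>0\<close>.\<close>

lemma alpha_composite_eq:
  "alpha_composite C G v w = gcomp C TTG
    (gcomp C TTG (Tflip C (garr G) \<cdot> w) (Tzero C (TO C (garr G)) \<cdot> v))
    (TA C (Tzero C (garr G)) \<cdot> pw_inv)"
  using T_zero_natural_at[of "ginv G" "Tproj C (TO C (garr G)) \<cdot> w"]
  by (simp add: alpha_composite_def Let_def structure_eqs_at(7) pw_inv_def)

lemma composable_fst: "composable TTG (Tflip C (garr G) \<cdot> w) (Tzero C (TO C (garr G)) \<cdot> v)"
proof -
  have "TA C (TA C (gsrc G)) \<cdot> (Tflip C (garr G) \<cdot> w) = Tzero C (TO C (gobj G)) \<cdot> y"
    using natural_at(4)[of "gsrc G" _ w] by (simp add: src_w structure_eqs_at(5))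
  moreover have "TA C (TA C (gtgt G)) \<cdot> (Tzero C (TO C (garr G)) \<cdot> v) = Tzero C (TO C (gobj G)) \<cdot> y"
    using natural_at(2)[of "TA C (gtgt G)" _ v] by (simp add: tgt_v)
  ultimately show ?thesis
    by (simp add: composable_def)
qed

lemma composable_snd: "composable TTG
  (gcomp C TTG (Tflip C (garr G) \<cdot> w) (Tzero C (TO C (garr G)) \<cdot> v))
  (TA C (Tzero C (garr G)) \<cdot> pw_inv)"
proof -
  have "TA C (TA C (gsrc G)) \<cdot> (Tzero C (TO C (garr G)) \<cdot> v) =
      TA C (Tzero C (gobj G)) \<cdot> (Tzero C (gobj G) \<cdot> m)"
    using natural_at(2)[of "TA C (gsrc G)" _ v] by (simp add: src_v natural_at(2))
  moreover have "TA C (TA C (gtgt G)) \<cdot> (TA C (Tzero C (garr G)) \<cdot> pw_inv) =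
      TA C (Tzero C (gobj G)) \<cdot> (Tzero C (gobj G) \<cdot> m)"
    using T_zero_natural_at[of "gtgt G" pw_inv] by (simp add: tgt_pw_inv)
  ultimately show ?thesis
    using gcomp_arr[OF groupoids(5) composable_fst] by (simp add: composable_def)
qed

lemma alpha_composite_arr [simp]:
  "alpha_composite C G v w \<in> arr C" "src C (alpha_composite C G v w) = W"
  "tgt C (alpha_composite C G v w) = TO C (TO C (garr G))"
  using gcomp_arr[OF groupoids(5) composable_fst] gcomp_arr[OF groupoids(5) composable_snd]
  by (simp_all add: alpha_composite_eq)

lemma src_alpha_composite: "TA C (TA C (gsrc G)) \<cdot> alpha_composite C G v w =
    TA C (Tzero C (gobj G)) \<cdot> (TA C (gtgt G) \<cdot> (Tproj C (TO C (garr G)) \<cdot> w))"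
  using gcomp_arr(4)[OF groupoids(5) composable_snd] T_zero_natural_at[of "gsrc G" pw_inv]
  by (simp add: alpha_composite_eq src_pw_inv)

lemma T_proj_alpha_composite: "TA C (Tproj C (garr G)) \<cdot> alpha_composite C G v w =
    TA C (gid G) \<cdot> (TA C (gtgt G) \<cdot> (Tproj C (TO C (garr G)) \<cdot> w))"
proof -
  let ?pw = "Tproj C (TO C (garr G)) \<cdot> w"
  have 1: "TA C (Tproj C (garr G)) \<cdot> (Tflip C (garr G) \<cdot> w) = ?pw"
    by (simp add: structure_eqs_at)
  have 2: "TA C (Tproj C (garr G)) \<cdot> (Tzero C (TO C (garr G)) \<cdot> v) =
      TA C (gid G) \<cdot> (TA C (gsrc G) \<cdot> ?pw)"
    using natural_at(2)[of "Tproj C (garr G)" _ v] by (simp add: proj_v src_pw zero_gid)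
  have 3: "TA C (Tproj C (garr G)) \<cdot> (TA C (Tzero C (garr G)) \<cdot> pw_inv) = TA C (ginv G) \<cdot> ?pw"
    using comp_cong_assoc[OF TA_comp[symmetric, of "Tzero C (garr G)" "Tproj C (garr G)"], of pw_inv]
    by (simp add: structure_eqs pw_inv_def)
  show ?thesis
    using gcomp_structure(2)[OF G composable_fst] gcomp_structure(2)[OF G composable_snd]
      groupoid_laws(1,3)[OF groupoids(4), of ?pw]
    by (simp add: alpha_composite_eq 1 2 3)
qed

lemma proj_alpha_composite: "Tproj C (TO C (garr G)) \<cdot> alpha_composite C G v w = v"
proof -
  have 1: "Tproj C (TO C (garr G)) \<cdot> (Tflip C (garr G) \<cdot> w) = TA C (gid G) \<cdot> (TA C (gtgt G) \<cdot> v)"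
    by (simp add: structure_eqs_at proj_w tgt_v)
  have 2: "Tproj C (TO C (garr G)) \<cdot> (Tzero C (TO C (garr G)) \<cdot> v) = v"
    by (simp add: structure_eqs_at)
  have "Tproj C (garr G) \<cdot> pw_inv =
      ginv G \<cdot> (Tproj C (garr G) \<cdot> (Tproj C (TO C (garr G)) \<cdot> w))"
    by (simp add: pw_inv_def natural_at)
  also have "Tproj C (garr G) \<cdot> (Tproj C (TO C (garr G)) \<cdot> w) =
      Tproj C (garr G) \<cdot> (TA C (gid G) \<cdot> y)"
    using natural_at(1)[of "Tproj C (garr G)" _ w] by (simp add: proj_w)
  also have "\<dots> = gid G \<cdot> m"
    by (simp add: natural_at proj_y)
  finally have "Tproj C (garr G) \<cdot> pw_inv = gid G \<cdot> m"
    by (simp add: ginv_gid[OF groupoids(3)])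
  then have 3: "Tproj C (TO C (garr G)) \<cdot> (TA C (Tzero C (garr G)) \<cdot> pw_inv) =
      TA C (gid G) \<cdot> (TA C (gsrc G) \<cdot> v)"
    using natural_at(1)[of "Tzero C (garr G)" _ pw_inv] by (simp add: zero_gid src_v)
  show ?thesis
    using gcomp_structure(1)[OF groupoids(1) composable_fst]
      gcomp_structure(1)[OF groupoids(1) composable_snd] groupoid_laws(1,2)[OF groupoids(4), of v]
    by (simp add: alpha_composite_eq 1 2 3)
qed

text \<open>The arrow \<open>z : W \<rightarrow> T(W)\<close> plays the part of the lift of the prolongation; it is only required to
  act on \<open>v\<close> and \<open>w\<close> as \<open>0\<close> and \<open>cT(l)\<close>.\<close>

lemma alpha_composite_linear:
  assumes z: "z \<in> arr C" "src C z = W" "tgt C z = TO C W"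
    and vz: "TA C v \<cdot> z = Tzero C (TO C (garr G)) \<cdot> v"
    and wz: "TA C w \<cdot> z = Tflip C (TO C (garr G)) \<cdot> (TA C (Tlift C (garr G)) \<cdot> w)"
  shows "TA C (alpha_composite C G v w) \<cdot> z = Tlift C (TO C (garr G)) \<cdot> alpha_composite C G v w"
proof -
  note [simp] = z
  let ?g = "garr G"
  let ?x = "Tflip C ?g \<cdot> w" and ?y = "Tzero C (TO C ?g) \<cdot> v" and ?z = "TA C (Tzero C ?g) \<cdot> pw_inv"
  have x: "TA C ?x \<cdot> z = Tlift C (TO C ?g) \<cdot> ?x"
    by (simp add: wz structure_eqs_at(8))
  have y: "TA C ?y \<cdot> z = Tlift C (TO C ?g) \<cdot> ?y"
    by (simp add: vz structure_eqs_at(3))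
  have "TA C pw_inv \<cdot> z = TA C (TA C (ginv G)) \<cdot> (TA C (Tproj C (TO C ?g)) \<cdot>
      (Tflip C (TO C ?g) \<cdot> (TA C (Tlift C ?g) \<cdot> w)))"
    by (simp add: pw_inv_def wz)
  also have "\<dots> = TA C (TA C (ginv G)) \<cdot> (Tproj C (TO C (TO C ?g)) \<cdot> (TA C (Tlift C ?g) \<cdot> w))"
    by (simp add: structure_eqs_at(6))
  also have "\<dots> = TA C (TA C (ginv G)) \<cdot> (Tlift C ?g \<cdot> (Tproj C (TO C ?g) \<cdot> w))"
    using natural_at(1)[of "Tlift C ?g" _ w] by simp
  also have "\<dots> = Tlift C ?g \<cdot> pw_inv"
    by (simp add: pw_inv_def natural_at(3))
  finally have z': "TA C ?z \<cdot> z = Tlift C (TO C ?g) \<cdot> ?z"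
    using natural_at(3)[of "Tzero C ?g" _ pw_inv] by simp
  note fst = TA_composable[OF groupoids(2) composable_fst]
  note snd = TA_composable[OF groupoids(2) composable_snd,
      unfolded TA_gcomp[OF groupoids(2) composable_fst]]
  have src: "tgt C z = src C (TA C ?x)" "tgt C z = src C (gcomp C TTTG (TA C ?x) (TA C ?y))"
    by (simp_all only: gcomp_arr(2)[OF groupoids(6) fst]) simp_all
  have "TA C (alpha_composite C G v w) \<cdot> z =
      gcomp C TTTG (gcomp C TTTG (TA C ?x) (TA C ?y)) (TA C ?z) \<cdot> z"
    by (simp only: alpha_composite_eq TA_gcomp[OF groupoids(2) composable_fst]
        TA_gcomp[OF groupoids(2) composable_snd])
  also have "\<dots> = gcomp C TTTG (gcomp C TTTG (TA C ?x) (TA C ?y) \<cdot> z) (TA C ?z \<cdot> z)"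
    by (rule gcomp_comp[OF groupoids(6) snd z(1) src(2), symmetric])
  also have "gcomp C TTTG (TA C ?x) (TA C ?y) \<cdot> z = gcomp C TTTG (TA C ?x \<cdot> z) (TA C ?y \<cdot> z)"
    by (rule gcomp_comp[OF groupoids(6) fst z(1) src(1), symmetric])
  also have "gcomp C TTTG \<dots> (TA C ?z \<cdot> z) = Tlift C (TO C ?g) \<cdot> alpha_composite C G v w"
    using gcomp_structure(3)[OF groupoids(1) composable_fst]
      gcomp_structure(3)[OF groupoids(1) composable_snd]
    by (simp only: x y z' alpha_composite_eq T_groupoid_sel)
  finally show ?thesis .
qed

end


section \<open>The anchored bundle and its prolongation\<close>

context tangent_category
begin

text \<open>A pullback of two arrows \<open>f\<close> and \<open>g\<close> into a product is a joint pullback of their components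
  \<open>f1\<close>, \<open>f2\<close> and \<open>g1\<close>, \<open>g2\<close>.\<close>

lemma product_pullback:
  assumes prod: "is_product C X Y Q j j'" and pb: "is_pullback C f g A a b"
    and f: "f1 \<in> arr C" "f2 \<in> arr C" "j \<cdot> f = f1" "j' \<cdot> f = f2"
    and g: "g1 \<in> arr C" "g2 \<in> arr C" "j \<cdot> g = g1" "j' \<cdot> g = g2"
    and Q: "tgt C f = Q"
  shows "f1 \<cdot> a = g1 \<cdot> b" "f2 \<cdot> a = g2 \<cdot> b"
    and "x \<in> arr C \<Longrightarrow> y \<in> arr C \<Longrightarrow> src C x = src C y \<Longrightarrow> tgt C x = src C f \<Longrightarrow> tgt C y = src C g \<Longrightarrow>
      f1 \<cdot> x = g1 \<cdot> y \<Longrightarrow> f2 \<cdot> x = g2 \<cdot> y \<Longrightarrow>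
      \<exists>u\<in>hom C (src C x) A. a \<cdot> u = x"
proof -
  have j [simp]: "j \<in> arr C" "j' \<in> arr C" "src C j = Q" "src C j' = Q"
    using prod unfolding is_product_def hom_def by blast+
  note D = is_pullbackD[OF pb]
  show "f1 \<cdot> a = g1 \<cdot> b" "f2 \<cdot> a = g2 \<cdot> b"
    using comp_cong_assoc[OF f(3), of a] comp_cong_assoc[OF g(3), of b]
      comp_cong_assoc[OF f(4), of a] comp_cong_assoc[OF g(4), of b] D Q by simp_all
  assume xy: "x \<in> arr C" "y \<in> arr C" "src C x = src C y" "tgt C x = src C f" "tgt C y = src C g"
    and eq: "f1 \<cdot> x = g1 \<cdot> y" "f2 \<cdot> x = g2 \<cdot> y"
  have "f \<cdot> x = g \<cdot> y"
  proof (rule product_eqI[OF prod])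
    show "j \<cdot> (f \<cdot> x) = j \<cdot> (g \<cdot> y)" "j' \<cdot> (f \<cdot> x) = j' \<cdot> (g \<cdot> y)"
      using comp_cong_assoc[OF f(3), of x] comp_cong_assoc[OF g(3), of y]
        comp_cong_assoc[OF f(4), of x] comp_cong_assoc[OF g(4), of y] D(1,2,9) Q xy eq by simp_all
  qed (use D(1,2,9) Q xy in simp_all)
  from pair_pullback[OF pb xy this] show "\<exists>u\<in>hom C (src C x) A. a \<cdot> u = x"
    by (auto simp: hom_def)
qed

text \<open>If the second projection of a pullback factors through the first, the first is a
  monomorphism.\<close>

lemma pullback_fst_mono:
  assumes pb: "is_pullback C f g A a b" and r: "b = r \<cdot> a" "r \<in> arr C" "src C r = tgt C a"
    and u: "u \<in> arr C" "u' \<in> arr C" "src C u = src C u'" "tgt C u = A" "tgt C u' = A"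
    and eq: "a \<cdot> u = a \<cdot> u'"
  shows "u = u'"
proof (rule pullback_eqI[OF pb u eq])
  show "b \<cdot> u = b \<cdot> u'"
    unfolding r(1) using is_pullbackD(3,5)[OF pb] r(2,3) u by (simp add: eq)
qed

end

text \<open>A groupoid, its associated anchored bundle and the prolongation of the latter.\<close>

locale groupoid_prolongation = tangent_category C
  for C :: "('o, 'a, 'x) tangent_data_scheme" (structure) +
  fixes G :: "('o, 'a) groupoid_data" and A P :: 'o and \<pi> \<iota> \<pi>0 \<pi>1 :: 'a
  assumes G: "tangent_groupoid C G"
    and A: "associated_anchored_bundle C G A \<pi> \<iota>"
    and P: "prolongation C G \<pi> \<iota> P \<pi>0 \<pi>1"
begin

lemmas G_arr [simp] = internal_groupoid_arr[OF tangent_groupoid_internal[OF G]]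

text \<open>The monomorphisms come from \<open>\<pi> = sp\<iota>\<close> and its images under \<open>T\<close>. By \<open>T_iota_factor\<close>, an element
  \<open>x\<close> of \<open>T\<^sup>2(G)\<close> lies in \<open>T(A)\<close> if it satisfies the two equations of the pullback for some \<open>y\<close>.\<close>

lemma anchored_bundle:
  shows iota [simp]: "\<iota> \<in> arr C" "src C \<iota> = A" "tgt C \<iota> = TO C (garr G)"
    and pi [simp]: "\<pi> \<in> arr C" "src C \<pi> = A" "tgt C \<pi> = gobj G"
    and A_obj [simp]: "A \<in> obj C"
    and proj_iota: "Tproj C (garr G) \<cdot> \<iota> = gid G \<cdot> \<pi>"
    and src_iota: "TA C (gsrc G) \<cdot> \<iota> = Tzero C (gobj G) \<cdot> \<pi>"
    and iota_mono: "\<And>u u'. u \<in> hom C X A \<Longrightarrow> u' \<in> hom C X A \<Longrightarrow> \<iota> \<cdot> u = \<iota> \<cdot> u' \<Longrightarrow> u = u'"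
    and T_iota_mono: "\<And>u u'. u \<in> hom C X (TO C A) \<Longrightarrow> u' \<in> hom C X (TO C A) \<Longrightarrow>
      TA C \<iota> \<cdot> u = TA C \<iota> \<cdot> u' \<Longrightarrow> u = u'"
    and TT_iota_mono: "\<And>u u'. u \<in> hom C X (TO C (TO C A)) \<Longrightarrow> u' \<in> hom C X (TO C (TO C A)) \<Longrightarrow>
      TA C (TA C \<iota>) \<cdot> u = TA C (TA C \<iota>) \<cdot> u' \<Longrightarrow> u = u'"
    and T_iota_factor: "\<And>x y. x \<in> hom C X (TO C (TO C (garr G))) \<Longrightarrow> y \<in> hom C X (TO C (gobj G)) \<Longrightarrow>
      TA C (Tproj C (garr G)) \<cdot> x = TA C (gid G) \<cdot> y \<Longrightarrow>
      TA C (TA C (gsrc G)) \<cdot> x = TA C (Tzero C (gobj G)) \<cdot> y \<Longrightarrow>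
      \<exists>u\<in>hom C X (TO C A). TA C \<iota> \<cdot> u = x"
proof -
  obtain Q j j' where prod: "preserved_product C (garr G) (TO C (gobj G)) Q j j'"
    and pb: "preserved_pullback C (pair C j j' (Tproj C (garr G)) (TA C (gsrc G)))
        (pair C j j' (gid G) (Tzero C (gobj G))) A \<iota> \<pi>"
    using A by (auto simp: associated_anchored_bundle_def)
  define f where "f = pair C j j' (Tproj C (garr G)) (TA C (gsrc G))"
  define g where "g = pair C j j' (gid G) (Tzero C (gobj G))"
  have prod0: "is_product C (garr G) (TO C (gobj G)) Q j j'"
    and prod1: "is_product C (TO C (garr G)) (TO C (TO C (gobj G))) (TO C Q) (TA C j) (TA C j')"
    using prod[unfolded preserved_product_def, rule_format, of 0]
      prod[unfolded preserved_product_def, rule_format, of 1] by simp_all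
  have j [simp]: "j \<in> arr C" "j' \<in> arr C" "src C j = Q" "src C j' = Q"
    using prod0 unfolding is_product_def hom_def by blast+
  have f [simp]: "f \<in> arr C" "src C f = TO C (garr G)" "tgt C f = Q"
    "j \<cdot> f = Tproj C (garr G)" "j' \<cdot> f = TA C (gsrc G)"
    using pair_product[OF prod0, of "Tproj C (garr G)" "TA C (gsrc G)"] by (simp_all add: f_def)
  have g [simp]: "g \<in> arr C" "src C g = gobj G" "tgt C g = Q"
    "j \<cdot> g = gid G" "j' \<cdot> g = Tzero C (gobj G)"
    using pair_product[OF prod0, of "gid G" "Tzero C (gobj G)"] by (simp_all add: g_def)
  note pb0 = pb[folded f_def g_def]
  note pb1 = preserved_pullbackD(2)[OF pb0]
  note pb2 = preserved_pullbackD(2)[OF pb1]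
  note D = is_pullbackD[OF preserved_pullbackD(1)[OF pb0]]
  show iota [simp]: "\<iota> \<in> arr C" "src C \<iota> = A" "tgt C \<iota> = TO C (garr G)"
    and pi [simp]: "\<pi> \<in> arr C" "src C \<pi> = A" "tgt C \<pi> = gobj G"
    using D(1-9) by simp_all
  show "A \<in> obj C"
    using src_obj[of \<iota>] by simp
  show proj_iota: "Tproj C (garr G) \<cdot> \<iota> = gid G \<cdot> \<pi>"
    and src_iota: "TA C (gsrc G) \<cdot> \<iota> = Tzero C (gobj G) \<cdot> \<pi>"
    by (rule product_pullback[OF prod0 preserved_pullbackD(1)[OF pb0]]; simp)+
  define r where "r = gsrc G \<cdot> Tproj C (garr G)"
  have r [simp]: "r \<in> arr C" "src C r = TO C (garr G)" "tgt C r = gobj G"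
    by (simp_all add: r_def)
  have r_eq: "\<pi> = r \<cdot> \<iota>"
    by (simp add: r_def proj_iota
        comp_cong_assoc[OF internal_groupoid_eqs(1)[OF tangent_groupoid_internal[OF G]]])
  have r1: "TA C \<pi> = TA C r \<cdot> TA C \<iota>"
    using arg_cong[OF r_eq, of "TA C"] by simp
  have r2: "TA C (TA C \<pi>) = TA C (TA C r) \<cdot> TA C (TA C \<iota>)"
    using arg_cong[OF r1, of "TA C"] by simp
  show "u = u'" if "u \<in> hom C X A" "u' \<in> hom C X A" "\<iota> \<cdot> u = \<iota> \<cdot> u'" for u u'
    by (rule pullback_fst_mono[OF preserved_pullbackD(1)[OF pb0] r_eq _ _ _ _ _ _ _ that(3)])
      (use that(1,2) in \<open>simp_all add: hom_def\<close>)
  show "u = u'" if "u \<in> hom C X (TO C A)" "u' \<in> hom C X (TO C A)"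
      "TA C \<iota> \<cdot> u = TA C \<iota> \<cdot> u'" for u u'
    by (rule pullback_fst_mono[OF preserved_pullbackD(1)[OF pb1] r1 _ _ _ _ _ _ _ that(3)])
      (use that(1,2) in \<open>simp_all add: hom_def\<close>)
  show "u = u'" if "u \<in> hom C X (TO C (TO C A))" "u' \<in> hom C X (TO C (TO C A))"
      "TA C (TA C \<iota>) \<cdot> u = TA C (TA C \<iota>) \<cdot> u'" for u u'
    by (rule pullback_fst_mono[OF preserved_pullbackD(1)[OF pb2] r2 _ _ _ _ _ _ _ that(3)])
      (use that(1,2) in \<open>simp_all add: hom_def\<close>)
  show "\<exists>u\<in>hom C X (TO C A). TA C \<iota> \<cdot> u = x"
    if xy: "x \<in> hom C X (TO C (TO C (garr G)))" "y \<in> hom C X (TO C (gobj G))"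
      and eq: "TA C (Tproj C (garr G)) \<cdot> x = TA C (gid G) \<cdot> y"
        "TA C (TA C (gsrc G)) \<cdot> x = TA C (Tzero C (gobj G)) \<cdot> y" for x y
  proof -
    have xy': "x \<in> arr C" "src C x = X" "tgt C x = TO C (TO C (garr G))"
      "y \<in> arr C" "src C y = X" "tgt C y = TO C (gobj G)"
      using xy by (simp_all add: hom_def)
    have "\<exists>u\<in>hom C (src C x) (TO C A). TA C \<iota> \<cdot> u = x"
      by (rule product_pullback(3)[OF prod1 preserved_pullbackD(1)[OF pb1] _ _ _ _ _ _ _ _ _ _ _ _ _ _ eq])
        (simp_all add: xy' flip: TA_comp)
    then show ?thesis
      by (simp add: xy')
  qed
qed

lemma prolongation_props:
  shows pi0 [simp]: "\<pi>0 \<in> arr C" "src C \<pi>0 = P" "tgt C \<pi>0 = A"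
    and pi1 [simp]: "\<pi>1 \<in> arr C" "src C \<pi>1 = P" "tgt C \<pi>1 = TO C A"
    and anchor_pi0: "TA C (gtgt G) \<cdot> (\<iota> \<cdot> \<pi>0) = TA C \<pi> \<cdot> \<pi>1"
    and T_prolongation: "is_pullback C (TA C (TA C (gtgt G) \<cdot> \<iota>)) (TA C (TA C \<pi>))
      (TO C P) (TA C \<pi>0) (TA C \<pi>1)"
proof -
  note pb = P[unfolded prolongation_def anchor_def]
  note D = is_pullbackD[OF preserved_pullbackD(1)[OF pb]]
  show pi0 [simp]: "\<pi>0 \<in> arr C" "src C \<pi>0 = P" "tgt C \<pi>0 = A"
    and "\<pi>1 \<in> arr C" "src C \<pi>1 = P" "tgt C \<pi>1 = TO C A"
    using D(1-9) by simp_all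
  show "TA C (gtgt G) \<cdot> (\<iota> \<cdot> \<pi>0) = TA C \<pi> \<cdot> \<pi>1"
    using D(10) by simp
  show "is_pullback C (TA C (TA C (gtgt G) \<cdot> \<iota>)) (TA C (TA C \<pi>)) (TO C P) (TA C \<pi>0) (TA C \<pi>1)"
    by (rule preserved_pullbackD(1)[OF preserved_pullbackD(2)[OF pb]])
qed

text \<open>The universal element of the prolongation.\<close>

sublocale prolongation_element C G P "\<iota> \<cdot> \<pi>0" "TA C \<iota> \<cdot> \<pi>1" "\<pi> \<cdot> \<pi>0" "TA C \<pi> \<cdot> \<pi>1"
proof
  show "tangent_groupoid C G" by (rule G)
  show "TA C (Tproj C (garr G)) \<cdot> (TA C \<iota> \<cdot> \<pi>1) = TA C (gid G) \<cdot> (TA C \<pi> \<cdot> \<pi>1)"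
    using comp_cong_assoc[OF TA_square[OF proj_iota], of \<pi>1] by simp
  show "TA C (TA C (gsrc G)) \<cdot> (TA C \<iota> \<cdot> \<pi>1) = TA C (Tzero C (gobj G)) \<cdot> (TA C \<pi> \<cdot> \<pi>1)"
    using comp_cong_assoc[OF TA_square[OF src_iota], of \<pi>1] by simp
qed (simp_all add: anchor_pi0 comp_cong_assoc[OF proj_iota] comp_cong_assoc[OF src_iota])

lemma alpha_props:
  shows "alpha C G A \<iota> P \<pi>0 \<pi>1 \<in> hom C P (TO C A)"
    and "TA C \<iota> \<cdot> alpha C G A \<iota> P \<pi>0 \<pi>1 = alpha_composite C G (\<iota> \<cdot> \<pi>0) (TA C \<iota> \<cdot> \<pi>1)"
proof -
  let ?a = "alpha_composite C G (\<iota> \<cdot> \<pi>0) (TA C \<iota> \<cdot> \<pi>1)"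
  have "\<exists>u\<in>hom C P (TO C A). TA C \<iota> \<cdot> u = ?a"
    by (rule T_iota_factor[OF _ _ T_proj_alpha_composite src_alpha_composite]) (simp_all add: hom_def)
  then have "\<exists>!u. u \<in> hom C P (TO C A) \<and> TA C \<iota> \<cdot> u = ?a"
    using T_iota_mono by metis
  from theI'[OF this] show "alpha C G A \<iota> P \<pi>0 \<pi>1 \<in> hom C P (TO C A)"
    "TA C \<iota> \<cdot> alpha C G A \<iota> P \<pi>0 \<pi>1 = ?a"
    by (simp_all add: alpha_def)
qed

lemma anchored_lift_props:
  shows lift_hom: "anchored_lift C G A \<iota> \<in> hom C A (TO C A)"
    and iota_lift: "TA C \<iota> \<cdot> anchored_lift C G A \<iota> = Tlift C (garr G) \<cdot> \<iota>"
    and pi_lift: "TA C \<pi> \<cdot> anchored_lift C G A \<iota> = Tzero C (gobj G) \<cdot> \<pi>"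
proof -
  have 1: "TA C (Tproj C (garr G)) \<cdot> (Tlift C (garr G) \<cdot> \<iota>) =
      TA C (gid G) \<cdot> (Tzero C (gobj G) \<cdot> \<pi>)"
    by (simp add: structure_eqs_at(2) proj_iota natural_at(2))
  have 2: "TA C (TA C (gsrc G)) \<cdot> (Tlift C (garr G) \<cdot> \<iota>) =
      TA C (Tzero C (gobj G)) \<cdot> (Tzero C (gobj G) \<cdot> \<pi>)"
    using natural_at(3)[of "gsrc G" _ \<iota>] by (simp add: src_iota structure_eqs_at(3))
  have "\<exists>u\<in>hom C A (TO C A). TA C \<iota> \<cdot> u = Tlift C (garr G) \<cdot> \<iota>"
    by (rule T_iota_factor[OF _ _ 1 2]) (simp_all add: hom_def)
  then have "\<exists>!u. u \<in> hom C A (TO C A) \<and> TA C \<iota> \<cdot> u = Tlift C (garr G) \<cdot> \<iota>"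
    using T_iota_mono by metis
  from theI'[OF this] show hom: "anchored_lift C G A \<iota> \<in> hom C A (TO C A)"
    and eq: "TA C \<iota> \<cdot> anchored_lift C G A \<iota> = Tlift C (garr G) \<cdot> \<iota>"
    by (simp_all add: anchored_lift_def)
  let ?l = "anchored_lift C G A \<iota>"
  have l [simp]: "?l \<in> arr C" "src C ?l = A" "tgt C ?l = TO C A"
    using hom by (simp_all add: hom_def)
  note E = internal_groupoid_eqs(1)[OF groupoids(4)]
  have "TA C (gid G) \<cdot> (TA C \<pi> \<cdot> ?l) = TA C (Tproj C (garr G)) \<cdot> (TA C \<iota> \<cdot> ?l)"
    using comp_cong_assoc[OF TA_square[OF proj_iota], of ?l] by simp
  also have "\<dots> = TA C (gid G) \<cdot> (Tzero C (gobj G) \<cdot> \<pi>)"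
    by (simp add: eq 1)
  finally have "TA C (gsrc G) \<cdot> (TA C (gid G) \<cdot> (TA C \<pi> \<cdot> ?l)) =
      TA C (gsrc G) \<cdot> (TA C (gid G) \<cdot> (Tzero C (gobj G) \<cdot> \<pi>))"
    by simp
  \<comment> \<open>\<open>T(e)\<close> is cancelled by its retraction \<open>T(s)\<close>.\<close>
  then show "TA C \<pi> \<cdot> ?l = Tzero C (gobj G) \<cdot> \<pi>"
    using comp_cong_assoc[OF E] by simp
qed

lemma anchored_lift_arr [simp]:
  "anchored_lift C G A \<iota> \<in> arr C" "src C (anchored_lift C G A \<iota>) = A"
  "tgt C (anchored_lift C G A \<iota>) = TO C A"
  using lift_hom by (simp_all add: hom_def)

lemma prolongation_lift_props:
  defines "z \<equiv> prolongation_lift C G A \<iota> \<pi>0 \<pi>1"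
  shows "z \<in> arr C" "src C z = P" "tgt C z = TO C P" "TA C \<pi>0 \<cdot> z = Tzero C A \<cdot> \<pi>0"
    "TA C \<pi>1 \<cdot> z = Tflip C A \<cdot> (TA C (anchored_lift C G A \<iota>) \<cdot> \<pi>1)"
proof -
  let ?l = "anchored_lift C G A \<iota>"
  \<comment> \<open>The pair \<open>(0v, cT(\<lambda>)w)\<close> lies in \<open>T(P)\<close>: \<open>T(\<varrho>)0v = 0\<varrho>v = 0T(\<pi>)w = cT(0)T(\<pi>)w =
    T\<^sup>2(\<pi>)cT(\<lambda>)w\<close>.\<close>
  have "TA C (TA C (gtgt G) \<cdot> \<iota>) \<cdot> (Tzero C A \<cdot> \<pi>0) =
      Tzero C (TO C (gobj G)) \<cdot> (TA C (gtgt G) \<cdot> (\<iota> \<cdot> \<pi>0))"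
    using natural_at(2)[of "TA C (gtgt G) \<cdot> \<iota>" _ \<pi>0] by simp
  also have "\<dots> = Tzero C (TO C (gobj G)) \<cdot> (TA C \<pi> \<cdot> \<pi>1)"
    by (simp only: anchor_pi0)
  also have "\<dots> = Tflip C (gobj G) \<cdot> (TA C (Tzero C (gobj G)) \<cdot> (TA C \<pi> \<cdot> \<pi>1))"
    by (simp add: structure_eqs_at(5))
  also have "\<dots> = Tflip C (gobj G) \<cdot> (TA C (TA C \<pi>) \<cdot> (TA C ?l \<cdot> \<pi>1))"
    using comp_cong_assoc[OF TA_square[OF pi_lift], of \<pi>1] by simp
  also have "\<dots> = TA C (TA C \<pi>) \<cdot> (Tflip C A \<cdot> (TA C ?l \<cdot> \<pi>1))"
    using natural_at(4)[of \<pi> _ "TA C ?l \<cdot> \<pi>1"] by simp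
  finally have eq: "TA C (TA C (gtgt G) \<cdot> \<iota>) \<cdot> (Tzero C A \<cdot> \<pi>0) =
      TA C (TA C \<pi>) \<cdot> (Tflip C A \<cdot> (TA C ?l \<cdot> \<pi>1))" .
  have z: "z = pair C (TA C \<pi>0) (TA C \<pi>1) (Tzero C A \<cdot> \<pi>0) (Tflip C A \<cdot> (TA C ?l \<cdot> \<pi>1))"
    by (simp add: z_def prolongation_lift_def)
  have "Tzero C A \<cdot> \<pi>0 \<in> arr C" "Tflip C A \<cdot> (TA C ?l \<cdot> \<pi>1) \<in> arr C"
    "src C (Tzero C A \<cdot> \<pi>0) = src C (Tflip C A \<cdot> (TA C ?l \<cdot> \<pi>1))"
    "tgt C (Tzero C A \<cdot> \<pi>0) = src C (TA C (TA C (gtgt G) \<cdot> \<iota>))"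
    "tgt C (Tflip C A \<cdot> (TA C ?l \<cdot> \<pi>1)) = src C (TA C (TA C \<pi>))"
    by simp_all
  note pair = pair_pullback[OF T_prolongation this eq, folded z]
  then show "z \<in> arr C" "src C z = P" "tgt C z = TO C P" "TA C \<pi>0 \<cdot> z = Tzero C A \<cdot> \<pi>0"
    "TA C \<pi>1 \<cdot> z = Tflip C A \<cdot> (TA C ?l \<cdot> \<pi>1)"
    by simp_all
qed

lemma alpha_linear: "linear_bundle_morphism C
    P A \<pi>0 (prolongation_lift C G A \<iota> \<pi>0 \<pi>1)
    (TO C A) A (Tproj C A) (Tlift C A)
    (ident C A) (alpha C G A \<iota> P \<pi>0 \<pi>1)"
proof -
  define \<alpha> where "\<alpha> = alpha C G A \<iota> P \<pi>0 \<pi>1"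
  define z where "z = prolongation_lift C G A \<iota> \<pi>0 \<pi>1"
  let ?l = "anchored_lift C G A \<iota>" and ?a = "alpha_composite C G (\<iota> \<cdot> \<pi>0) (TA C \<iota> \<cdot> \<pi>1)"
  have \<alpha> [simp]: "\<alpha> \<in> arr C" "src C \<alpha> = P" "tgt C \<alpha> = TO C A"
    using alpha_props(1) by (simp_all add: \<alpha>_def hom_def)
  have iota_\<alpha>: "TA C \<iota> \<cdot> \<alpha> = ?a"
    using alpha_props(2) by (simp add: \<alpha>_def)
  note z = prolongation_lift_props[folded z_def]
  note [simp] = z(1-3)
  have over_id: "Tproj C A \<cdot> \<alpha> = \<pi>0"
  proof (rule iota_mono)
    have "\<iota> \<cdot> (Tproj C A \<cdot> \<alpha>) = Tproj C (TO C (garr G)) \<cdot> (TA C \<iota> \<cdot> \<alpha>)"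
      using natural_at(1)[of \<iota> _ \<alpha>] by simp
    then show "\<iota> \<cdot> (Tproj C A \<cdot> \<alpha>) = \<iota> \<cdot> \<pi>0"
      by (simp add: iota_\<alpha> proj_alpha_composite)
  qed (simp_all add: hom_def)
  have linear: "TA C \<alpha> \<cdot> z = Tlift C A \<cdot> \<alpha>"
  proof (rule TT_iota_mono)
    have "TA C (\<iota> \<cdot> \<pi>0) \<cdot> z = Tzero C (TO C (garr G)) \<cdot> (\<iota> \<cdot> \<pi>0)"
      using natural_at(2)[of \<iota> _ \<pi>0] by (simp add: z(4))
    moreover have "TA C (TA C \<iota> \<cdot> \<pi>1) \<cdot> z =
        Tflip C (TO C (garr G)) \<cdot> (TA C (Tlift C (garr G)) \<cdot> (TA C \<iota> \<cdot> \<pi>1))"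
    proof -
      have "TA C (TA C \<iota> \<cdot> \<pi>1) \<cdot> z = Tflip C (TO C (garr G)) \<cdot> (TA C (TA C \<iota>) \<cdot> (TA C ?l \<cdot> \<pi>1))"
        using natural_at(4)[of \<iota> _ "TA C ?l \<cdot> \<pi>1"] by (simp add: z(5))
      also have "TA C (TA C \<iota>) \<cdot> (TA C ?l \<cdot> \<pi>1) = TA C (Tlift C (garr G)) \<cdot> (TA C \<iota> \<cdot> \<pi>1)"
        using comp_cong_assoc[OF TA_square[OF iota_lift], of \<pi>1] by simp
      finally show ?thesis .
    qed
    ultimately have "TA C ?a \<cdot> z = Tlift C (TO C (garr G)) \<cdot> ?a"
      by (intro alpha_composite_linear) simp_all
    moreover have "TA C (TA C \<iota>) \<cdot> (TA C \<alpha> \<cdot> z) = TA C ?a \<cdot> z"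
      by (simp flip: iota_\<alpha>)
    moreover have "TA C (TA C \<iota>) \<cdot> (Tlift C A \<cdot> \<alpha>) = Tlift C (TO C (garr G)) \<cdot> ?a"
      using natural_at(3)[of \<iota> _ \<alpha>] by (simp add: iota_\<alpha>)
    ultimately show "TA C (TA C \<iota>) \<cdot> (TA C \<alpha> \<cdot> z) = TA C (TA C \<iota>) \<cdot> (Tlift C A \<cdot> \<alpha>)"
      by simp
  qed (simp_all add: hom_def)
  show ?thesis
    unfolding linear_bundle_morphism_def \<alpha>_def[symmetric] z_def[symmetric]
    by (simp add: hom_def over_id linear)
qed

end

theorem lemma3p3p0p6:
  fixes C :: "('o, 'a) tangent_data"
    and G :: "('o, 'a) groupoid_data"
    and A P :: 'o
    and \<pi> \<iota> \<pi>0 \<pi>1 :: 'a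
  assumes "tangent_category_with_negatives C"
    and "tangent_groupoid C G"
    and "associated_anchored_bundle C G A \<pi> \<iota>"
    and "prolongation C G \<pi> \<iota> P \<pi>0 \<pi>1"
  shows "linear_bundle_morphism C
    P A \<pi>0 (prolongation_lift C G A \<iota> \<pi>0 \<pi>1)
    (TO C A) A (Tproj C A) (Tlift C A)
    (ident C A) (alpha C G A \<iota> P \<pi>0 \<pi>1)"
proof -
  interpret tangent_category_with_negatives C
    by (rule assms(1))
  interpret groupoid_prolongation C G A P \<pi> \<iota> \<pi>0 \<pi>1
    by unfold_locales (rule assms)+
  show ?thesis
    by (rule alpha_linear)
qed

end
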